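(* Let $(M,\phi,\xi,\eta,g,\nabla=\nabla^\circ+K)$ be an almost contact statistical manifold and let $\lambda=g(K(\xi,\xi),\xi)\in C^\infty(M)$. Then the following statements are equivalent: (1) $\mathcal{K}_\phi=0$; (2) $\mathcal{K}^S_\phi=\mathcal{K}^\circ_\phi$; (3) $K=\lambda\,\eta\otimes\eta\otimes\xi=\eta\otimes\eta\otimes K(\xi,\xi)$, i.e. $K(X,Y)=\lambda\eta(X)\eta(Y)\xi=\eta(X)\eta(Y)K(\xi,\xi)$ for all $X,Y\in\mathfrak{X}(M)$; (4) $[K,K]=0$; (5) $S=R^\circ$; (6) $K(X,X)=0$ for all $X\in\mathfrak{X}(M)$ with $X\perp\xi$; (7) $K(X,\phi X)=0$ for all $X\in\mathfrak{X}(M)$; (8) $\phi K(X,X)=0$ for all $X\in\mathfrak{X}(M)$; (9) $K(X,X)\parallel\xi$ for all $X\in\mathfrak{X}(M)$.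
   Context: An almost contact metric manifold $(M,\phi,\xi,\eta,g)$ is an odd-dimensional smooth manifold $M$ with a $(1,1)$-tensor field $\phi$, a vector field $\xi$, a 1-form $\eta$ and a Riemannian metric $g$ satisfying $\phi^2=-I+\eta\otimes\xi$, $\eta(\xi)=1$ and $g(\phi X,\phi Y)=g(X,Y)-\eta(X)\eta(Y)$ for all vector fields $X,Y$. Let $\nabla^\circ$ be the Levi-Civita connection of $g$. A statistical structure on $M$ is a pair $(g,\nabla)$ with $\nabla$ a torsion-free affine connection such that the 3-tensor $\nabla g$ is totally symmetric; put $K=\nabla-\nabla^\circ$, a $(1,2)$-tensor field which is symmetric, and such that $g(X,K(Y,Z))$ is totally symmetric in $X,Y,Z$. An almost contact statistical manifold $(M,\phi,\xi,\eta,g,\nabla=\nabla^\circ+K)$ is an almost contact metric manifold with a statistical structure $(g,\nabla)$ such that $K(X,\phi Y)+\phi K(X,Y)=0$ for all vector fields $X,Y$. Write $K_XY=K(X,Y)$ and $[K,K](X,Y)Z=K_XK_YZ-K_YK_XZ$. The conjugate connection is $\bar\nabla=\nabla^\circ-K$; $R,\bar R,R^\circ$ are the curvature tensors of $\nabla,\bar\nabla,\nabla^\circ$ (with $R(X,Y)Z=\nabla_X\nabla_YZ-\nabla_Y\nabla_XZ-\nabla_{[X,Y]}Z$), and $S(X,Y)Z=\frac12\{R(X,Y)Z+\bar R(X,Y)Z\}$ is the statistical curvature tensor field. A $\phi$-section of $T_pM$ is a 2-dimensional subspace spanned by $\{X,\phi X\}$ for some $X\in T_pM$ orthogonal to $\xi$.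 With $Q(X,\phi X)=g(X,X)g(\phi X,\phi X)-g(X,\phi X)^2$, the $\phi$-sectional $K$-curvature $\mathcal{K}_\phi(X)$, the statistical $\phi$-sectional curvature $\mathcal{K}^S_\phi(X)$ and the Riemannian $\phi$-sectional curvature $\mathcal{K}^\circ_\phi(X)$ are the quotients $g(T(X,\phi X)\phi X,X)/Q(X,\phi X)$ with $T=[K,K]$, $T=S$, $T=R^\circ$ respectively. Equalities between these curvatures (such as $\mathcal{K}_\phi=0$) mean equality at all points for all $\phi$-sections. $V\parallel\xi$ means $V$ is a (possibly zero) pointwise scalar multiple of $\xi$. *)

theory Defs
  imports "HOL-Analysis.Analysis"
begin

section \<open>Smooth maps between Euclidean spaces\<close>

text \<open>Used for open sets \<open>S\<close> and finite-dimensional domains only, where this is the usual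
  notion of a \<open>k\<close> times continuously differentiable map.\<close>

primrec Ck_on :: "nat \<Rightarrow> 'a::real_normed_vector set \<Rightarrow> ('a \<Rightarrow> 'b::real_normed_vector) \<Rightarrow> bool" where
  "Ck_on 0 S f \<longleftrightarrow> continuous_on S f"
| "Ck_on (Suc k) S f \<longleftrightarrow>
     (\<forall>x\<in>S. f differentiable (at x)) \<and> (\<forall>v. Ck_on k S (\<lambda>x. frechet_derivative f (at x) v))"

definition smooth_on :: "'a::real_normed_vector set \<Rightarrow> ('a \<Rightarrow> 'b::real_normed_vector) \<Rightarrow> bool" where
  "smooth_on S f \<longleftrightarrow> (\<forall>k. Ck_on k S f)"


section \<open>Smooth manifolds\<close>

text \<open>The points of the manifold are the elements of a Hausdorff, second countable type \<open>'m\<close>;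
  the model space is the Euclidean space \<open>'e\<close>.  A chart is a pair of its domain and its
  coordinate map; the values of the coordinate map outside the domain are irrelevant.
  The smooth structure is given by an atlas, which need not be maximal.\<close>

type_synonym ('m, 'e) chart = "'m set \<times> ('m \<Rightarrow> 'e)"

definition chart_inv :: "('m, 'e) chart \<Rightarrow> 'e \<Rightarrow> 'm" where
  "chart_inv c = inv_into (fst c) (snd c)"

definition is_chart :: "('m::topological_space, 'e::euclidean_space) chart \<Rightarrow> bool" where
  "is_chart c \<longleftrightarrow> open (fst c) \<and> open (snd c ` fst c) \<and>
     homeomorphism (fst c) (snd c ` fst c) (snd c) (chart_inv c)"

definition smooth_atlas ::
    "('m::{t2_space,second_countable_topology}, 'e::euclidean_space) chart set \<Rightarrow> bool" where
  "smooth_atlas A \<longleftrightarrow>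
     (\<forall>c\<in>A. is_chart c) \<and> (\<Union>c\<in>A. fst c) = UNIV \<and>
     (\<forall>c\<in>A. \<forall>d\<in>A. smooth_on (snd c ` (fst c \<inter> fst d)) (snd d \<circ> chart_inv c))"

definition smooth_functions :: "('m, 'e::euclidean_space) chart set \<Rightarrow> ('m \<Rightarrow> real) set" where
  "smooth_functions A = {f. \<forall>c\<in>A. smooth_on (snd c ` fst c) (f \<circ> chart_inv c)}"


section \<open>Tangent vectors and vector fields\<close>

text \<open>A tangent vector at \<open>p\<close> is given by its components in all charts around \<open>p\<close>, which
  transform by the differentials of the coordinate changes.  The type below is the vector space
  of all families of components indexed by charts; the tangent spaces are subspaces of it.\<close>

typedef ('m, 'e) tvec = "UNIV :: (('m, 'e) chart \<Rightarrow> 'e) set"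
  morphisms components Tvec
  by simp

instantiation tvec :: (type, real_vector) real_vector
begin

definition zero_tvec :: "('a, 'b) tvec" where
  "zero_tvec = Tvec (\<lambda>c. 0)"

definition plus_tvec :: "('a, 'b) tvec \<Rightarrow> ('a, 'b) tvec \<Rightarrow> ('a, 'b) tvec" where
  "plus_tvec v w = Tvec (\<lambda>c. components v c + components w c)"

definition minus_tvec :: "('a, 'b) tvec \<Rightarrow> ('a, 'b) tvec \<Rightarrow> ('a, 'b) tvec" where
  "minus_tvec v w = Tvec (\<lambda>c. components v c - components w c)"

definition uminus_tvec :: "('a, 'b) tvec \<Rightarrow> ('a, 'b) tvec" where
  "uminus_tvec v = Tvec (\<lambda>c. - components v c)"

definition scaleR_tvec :: "real \<Rightarrow> ('a, 'b) tvec \<Rightarrow> ('a, 'b) tvec" where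
  "scaleR_tvec r v = Tvec (\<lambda>c. r *\<^sub>R components v c)"

instance
  by standard
    (simp_all add: zero_tvec_def plus_tvec_def minus_tvec_def uminus_tvec_def scaleR_tvec_def
      Tvec_inverse components_inverse algebra_simps flip: components_inject)

end

definition tangent_space :: "('m, 'e::euclidean_space) chart set \<Rightarrow> 'm \<Rightarrow> ('m, 'e) tvec set" where
  "tangent_space A p = {v.
     (\<forall>c. \<not> (c \<in> A \<and> p \<in> fst c) \<longrightarrow> components v c = 0) \<and>
     (\<forall>c\<in>A. \<forall>d\<in>A. p \<in> fst c \<inter> fst d \<longrightarrow>
        components v d = frechet_derivative (snd d \<circ> chart_inv c) (at (snd c p)) (components v c))}"

type_synonym ('m, 'e) vfield = "'m \<Rightarrow> ('m, 'e) tvec"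

definition vector_fields :: "('m, 'e::euclidean_space) chart set \<Rightarrow> ('m, 'e) vfield set" where
  "vector_fields A = {X. (\<forall>p. X p \<in> tangent_space A p) \<and>
     (\<forall>c\<in>A. smooth_on (snd c ` fst c) (\<lambda>x. components (X (chart_inv c x)) c))}"

text \<open>The derivative \<open>X f\<close>; by the transformation law it does not depend on the chart chosen
  around \<open>p\<close>.\<close>

definition vf_deriv ::
    "('m, 'e::euclidean_space) chart set \<Rightarrow> ('m, 'e) vfield \<Rightarrow> ('m \<Rightarrow> real) \<Rightarrow> 'm \<Rightarrow> real" where
  "vf_deriv A X f p = (let c = (SOME c. c \<in> A \<and> p \<in> fst c) in
     frechet_derivative (f \<circ> chart_inv c) (at (snd c p)) (components (X p) c))"

text \<open>The Lie bracket in local coordinates, \<open>[X,Y]\<^sup>i = X\<^sup>j \<partial>\<^sub>j Y\<^sup>i - Y\<^sup>j \<partial>\<^sub>j X\<^sup>i\<close>.\<close>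

definition lie_bracket ::
    "('m, 'e::euclidean_space) chart set \<Rightarrow> ('m, 'e) vfield \<Rightarrow> ('m, 'e) vfield \<Rightarrow> ('m, 'e) vfield" where
  "lie_bracket A X Y = (\<lambda>p. Tvec (\<lambda>c. if c \<in> A \<and> p \<in> fst c then
       frechet_derivative (\<lambda>x. components (Y (chart_inv c x)) c) (at (snd c p)) (components (X p) c)
     - frechet_derivative (\<lambda>x. components (X (chart_inv c x)) c) (at (snd c p)) (components (Y p) c)
     else 0))"


section \<open>Tensor fields\<close>

text \<open>Tensor fields are given pointwise by multilinear maps on the tangent spaces (their values on
  arguments outside the tangent space are irrelevant); smoothness means that evaluation on smooth
  vector fields gives smooth functions or vector fields.\<close>

definition linear_on :: "'a::real_vector set \<Rightarrow> ('a \<Rightarrow> 'b::real_vector) \<Rightarrow> bool" where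
  "linear_on V f \<longleftrightarrow> (\<forall>x\<in>V. \<forall>y\<in>V. f (x + y) = f x + f y) \<and> (\<forall>r. \<forall>x\<in>V. f (r *\<^sub>R x) = r *\<^sub>R f x)"

definition endomorphism_field ::
    "('m, 'e::euclidean_space) chart set \<Rightarrow> ('m \<Rightarrow> ('m, 'e) tvec \<Rightarrow> ('m, 'e) tvec) \<Rightarrow> bool" where
  "endomorphism_field A \<phi> \<longleftrightarrow>
     (\<forall>p. linear_on (tangent_space A p) (\<phi> p) \<and> \<phi> p ` tangent_space A p \<subseteq> tangent_space A p) \<and>
     (\<forall>X\<in>vector_fields A. (\<lambda>p. \<phi> p (X p)) \<in> vector_fields A)"

definition one_form ::
    "('m, 'e::euclidean_space) chart set \<Rightarrow> ('m \<Rightarrow> ('m, 'e) tvec \<Rightarrow> real) \<Rightarrow> bool" where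
  "one_form A \<eta> \<longleftrightarrow>
     (\<forall>p. linear_on (tangent_space A p) (\<eta> p)) \<and>
     (\<forall>X\<in>vector_fields A. (\<lambda>p. \<eta> p (X p)) \<in> smooth_functions A)"

type_synonym ('m, 'e) metric = "'m \<Rightarrow> ('m, 'e) tvec \<Rightarrow> ('m, 'e) tvec \<Rightarrow> real"

definition riemannian_metric ::
    "('m, 'e::euclidean_space) chart set \<Rightarrow> ('m, 'e) metric \<Rightarrow> bool" where
  "riemannian_metric A g \<longleftrightarrow>
     (\<forall>p. \<forall>v\<in>tangent_space A p. linear_on (tangent_space A p) (g p v)) \<and>
     (\<forall>p. \<forall>v\<in>tangent_space A p. \<forall>w\<in>tangent_space A p. g p v w = g p w v) \<and>
     (\<forall>p. \<forall>v\<in>tangent_space A p. v \<noteq> 0 \<longrightarrow> g p v v > 0) \<and>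
     (\<forall>X\<in>vector_fields A. \<forall>Y\<in>vector_fields A. (\<lambda>p. g p (X p) (Y p)) \<in> smooth_functions A)"


section \<open>Affine connections\<close>

type_synonym ('m, 'e) connection = "('m, 'e) vfield \<Rightarrow> ('m, 'e) vfield \<Rightarrow> ('m, 'e) vfield"

definition affine_connection ::
    "('m, 'e::euclidean_space) chart set \<Rightarrow> ('m, 'e) connection \<Rightarrow> bool" where
  "affine_connection A D \<longleftrightarrow>
     (\<forall>X\<in>vector_fields A. \<forall>Y\<in>vector_fields A. D X Y \<in> vector_fields A) \<and>
     (\<forall>X\<in>vector_fields A. \<forall>Y\<in>vector_fields A. \<forall>Z\<in>vector_fields A.
        D (\<lambda>p. X p + Y p) Z = (\<lambda>p. D X Z p + D Y Z p) \<and>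
        D X (\<lambda>p. Y p + Z p) = (\<lambda>p. D X Y p + D X Z p)) \<and>
     (\<forall>f\<in>smooth_functions A. \<forall>X\<in>vector_fields A. \<forall>Y\<in>vector_fields A.
        D (\<lambda>p. f p *\<^sub>R X p) Y = (\<lambda>p. f p *\<^sub>R D X Y p) \<and>
        D X (\<lambda>p. f p *\<^sub>R Y p) = (\<lambda>p. vf_deriv A X f p *\<^sub>R Y p + f p *\<^sub>R D X Y p))"

definition torsion_free ::
    "('m, 'e::euclidean_space) chart set \<Rightarrow> ('m, 'e) connection \<Rightarrow> bool" where
  "torsion_free A D \<longleftrightarrow> (\<forall>X\<in>vector_fields A. \<forall>Y\<in>vector_fields A.
     (\<lambda>p. D X Y p - D Y X p) = lie_bracket A X Y)"

text \<open>\<open>(\<nabla>\<^sub>X g)(Y,Z)\<close>\<close>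

definition cov_deriv_metric ::
    "('m, 'e::euclidean_space) chart set \<Rightarrow> ('m, 'e) connection \<Rightarrow> ('m, 'e) metric \<Rightarrow>
     ('m, 'e) vfield \<Rightarrow> ('m, 'e) vfield \<Rightarrow> ('m, 'e) vfield \<Rightarrow> 'm \<Rightarrow> real" where
  "cov_deriv_metric A D g X Y Z p =
     vf_deriv A X (\<lambda>q. g q (Y q) (Z q)) p - g p (D X Y p) (Z p) - g p (Y p) (D X Z p)"

definition levi_civita ::
    "('m, 'e::euclidean_space) chart set \<Rightarrow> ('m, 'e) metric \<Rightarrow> ('m, 'e) connection \<Rightarrow> bool" where
  "levi_civita A g D \<longleftrightarrow> affine_connection A D \<and> torsion_free A D \<and>
     (\<forall>X\<in>vector_fields A. \<forall>Y\<in>vector_fields A. \<forall>Z\<in>vector_fields A. \<forall>p.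
        cov_deriv_metric A D g X Y Z p = 0)"

definition statistical_structure ::
    "('m, 'e::euclidean_space) chart set \<Rightarrow> ('m, 'e) metric \<Rightarrow> ('m, 'e) connection \<Rightarrow> bool" where
  "statistical_structure A g D \<longleftrightarrow> riemannian_metric A g \<and> affine_connection A D \<and> torsion_free A D \<and>
     (\<forall>X\<in>vector_fields A. \<forall>Y\<in>vector_fields A. \<forall>Z\<in>vector_fields A. \<forall>p.
        cov_deriv_metric A D g X Y Z p = cov_deriv_metric A D g Y X Z p \<and>
        cov_deriv_metric A D g X Y Z p = cov_deriv_metric A D g X Z Y p)"

text \<open>\<open>R(X,Y)Z\<close>\<close>

definition curvature ::
    "('m, 'e::euclidean_space) chart set \<Rightarrow> ('m, 'e) connection \<Rightarrow>
     ('m, 'e) vfield \<Rightarrow> ('m, 'e) vfield \<Rightarrow> ('m, 'e) vfield \<Rightarrow> ('m, 'e) vfield" where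
  "curvature A D X Y Z = (\<lambda>p. D X (D Y Z) p - D Y (D X Z) p - D (lie_bracket A X Y) Z p)"


section \<open>Almost contact statistical manifolds\<close>

definition almost_contact_metric_manifold ::
    "('m::{t2_space,second_countable_topology}, 'e::euclidean_space) chart set \<Rightarrow>
     ('m \<Rightarrow> ('m, 'e) tvec \<Rightarrow> ('m, 'e) tvec) \<Rightarrow> ('m, 'e) vfield \<Rightarrow>
     ('m \<Rightarrow> ('m, 'e) tvec \<Rightarrow> real) \<Rightarrow> ('m, 'e) metric \<Rightarrow> bool" where
  "almost_contact_metric_manifold A \<phi> \<xi> \<eta> g \<longleftrightarrow>
     smooth_atlas A \<and> odd DIM('e) \<and>
     endomorphism_field A \<phi> \<and> \<xi> \<in> vector_fields A \<and> one_form A \<eta> \<and> riemannian_metric A g \<and>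
     (\<forall>p. \<forall>v\<in>tangent_space A p. \<phi> p (\<phi> p v) = - v + \<eta> p v *\<^sub>R \<xi> p) \<and>
     (\<forall>p. \<eta> p (\<xi> p) = 1) \<and>
     (\<forall>p. \<forall>v\<in>tangent_space A p. \<forall>w\<in>tangent_space A p.
        g p (\<phi> p v) (\<phi> p w) = g p v w - \<eta> p v * \<eta> p w)"

text \<open>In the following definitions \<open>nabla0\<close> is the Levi-Civita connection of \<open>g\<close>.\<close>

definition difference_tensor ::
    "('m, 'e::euclidean_space) connection \<Rightarrow> ('m, 'e) connection \<Rightarrow>
     ('m, 'e) vfield \<Rightarrow> ('m, 'e) vfield \<Rightarrow> ('m, 'e) vfield" where
  "difference_tensor nabla nabla0 X Y = (\<lambda>p. nabla X Y p - nabla0 X Y p)"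

definition almost_contact_statistical_manifold ::
    "('m::{t2_space,second_countable_topology}, 'e::euclidean_space) chart set \<Rightarrow>
     ('m \<Rightarrow> ('m, 'e) tvec \<Rightarrow> ('m, 'e) tvec) \<Rightarrow> ('m, 'e) vfield \<Rightarrow>
     ('m \<Rightarrow> ('m, 'e) tvec \<Rightarrow> real) \<Rightarrow> ('m, 'e) metric \<Rightarrow>
     ('m, 'e) connection \<Rightarrow> ('m, 'e) connection \<Rightarrow> bool" where
  "almost_contact_statistical_manifold A \<phi> \<xi> \<eta> g nabla0 nabla \<longleftrightarrow>
     almost_contact_metric_manifold A \<phi> \<xi> \<eta> g \<and> levi_civita A g nabla0 \<and>
     statistical_structure A g nabla \<and>
     (\<forall>X\<in>vector_fields A. \<forall>Y\<in>vector_fields A. \<forall>p.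
        difference_tensor nabla nabla0 X (\<lambda>q. \<phi> q (Y q)) p
        + \<phi> p (difference_tensor nabla nabla0 X Y p) = 0)"

text \<open>\<open>[K,K](X,Y)Z\<close>\<close>

definition K_bracket ::
    "(('m, 'e::euclidean_space) vfield \<Rightarrow> ('m, 'e) vfield \<Rightarrow> ('m, 'e) vfield) \<Rightarrow>
     ('m, 'e) vfield \<Rightarrow> ('m, 'e) vfield \<Rightarrow> ('m, 'e) vfield \<Rightarrow> ('m, 'e) vfield" where
  "K_bracket K X Y Z = (\<lambda>p. K X (K Y Z) p - K Y (K X Z) p)"

definition conjugate_connection ::
    "('m, 'e::euclidean_space) connection \<Rightarrow> ('m, 'e) connection \<Rightarrow> ('m, 'e) connection" where
  "conjugate_connection nabla0 nabla X Y = (\<lambda>p. nabla0 X Y p - difference_tensor nabla nabla0 X Y p)"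

definition statistical_curvature ::
    "('m, 'e::euclidean_space) chart set \<Rightarrow> ('m, 'e) connection \<Rightarrow> ('m, 'e) connection \<Rightarrow>
     ('m, 'e) vfield \<Rightarrow> ('m, 'e) vfield \<Rightarrow> ('m, 'e) vfield \<Rightarrow> ('m, 'e) vfield" where
  "statistical_curvature A nabla0 nabla X Y Z = (\<lambda>p. (1/2) *\<^sub>R
     (curvature A nabla X Y Z p + curvature A (conjugate_connection nabla0 nabla) X Y Z p))"


section \<open>Sectional curvatures\<close>

text \<open>The value at \<open>p\<close> of a tensor field \<open>T\<close>, given as an operator on vector fields, on tangent
  vectors at \<open>p\<close>: the vectors are extended to vector fields in an arbitrary way.  For
  function-linear \<open>T\<close> the result does not depend on the extensions.\<close>

definition extension ::
    "('m, 'e::euclidean_space) chart set \<Rightarrow> 'm \<Rightarrow> ('m, 'e) tvec \<Rightarrow> ('m, 'e) vfield" where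
  "extension A p v = (SOME X. X \<in> vector_fields A \<and> X p = v)"

definition tensor_at ::
    "('m, 'e::euclidean_space) chart set \<Rightarrow>
     (('m, 'e) vfield \<Rightarrow> ('m, 'e) vfield \<Rightarrow> ('m, 'e) vfield \<Rightarrow> ('m, 'e) vfield) \<Rightarrow>
     'm \<Rightarrow> ('m, 'e) tvec \<Rightarrow> ('m, 'e) tvec \<Rightarrow> ('m, 'e) tvec \<Rightarrow> ('m, 'e) tvec" where
  "tensor_at A T p u v w = T (extension A p u) (extension A p v) (extension A p w) p"

definition spans_phi_section ::
    "('m, 'e::euclidean_space) chart set \<Rightarrow> ('m \<Rightarrow> ('m, 'e) tvec \<Rightarrow> ('m, 'e) tvec) \<Rightarrow>
     ('m, 'e) vfield \<Rightarrow> ('m, 'e) metric \<Rightarrow> 'm \<Rightarrow> ('m, 'e) tvec \<Rightarrow> bool" where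
  "spans_phi_section A \<phi> \<xi> g p v \<longleftrightarrow>
     v \<in> tangent_space A p \<and> g p v (\<xi> p) = 0 \<and> dim (span {v, \<phi> p v}) = 2"

definition phi_sectional ::
    "('m, 'e::euclidean_space) chart set \<Rightarrow> ('m \<Rightarrow> ('m, 'e) tvec \<Rightarrow> ('m, 'e) tvec) \<Rightarrow>
     ('m, 'e) metric \<Rightarrow>
     (('m, 'e) vfield \<Rightarrow> ('m, 'e) vfield \<Rightarrow> ('m, 'e) vfield \<Rightarrow> ('m, 'e) vfield) \<Rightarrow>
     'm \<Rightarrow> ('m, 'e) tvec \<Rightarrow> real" where
  "phi_sectional A \<phi> g T p v =
     g p (tensor_at A T p v (\<phi> p v) (\<phi> p v)) v
     / (g p v v * g p (\<phi> p v) (\<phi> p v) - (g p v (\<phi> p v))\<^sup>2)"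


definition all_equivalent :: "bool list \<Rightarrow> bool" where
  "all_equivalent Ps \<longleftrightarrow> (\<forall>P\<in>set Ps. \<forall>Q\<in>set Ps. P \<longleftrightarrow> Q)"

end

theory Submission
  imports Defs
begin

text \<open>
  Everything reduces to one pointwise condition: \<open>K\<^sub>p(v,v) = 0\<close> for all points \<open>p\<close> and all
  \<open>v \<in> T\<^sub>pM\<close> orthogonal to \<open>\<xi>\<close>.  Each of the nine statements is shown to be equivalent to it.

  The algebra at a point is short.  The relation \<open>K\<^sub>X \<phi> = - \<phi> K\<^sub>X\<close> with \<open>\<phi> \<xi> = 0\<close> puts \<open>K(X,\<xi>)\<close> into the
  kernel of \<open>\<phi>\<close>, which is spanned by \<open>\<xi>\<close>, and the total symmetry of \<open>g(K(X,Y),Z)\<close> then gives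
  \<open>K(X,\<xi>) = \<lambda> \<eta>(X) \<xi>\<close>.  So \<open>K\<close> is determined by \<open>\<lambda>\<close> and by its restriction to the horizontal space
  \<open>\<xi>\<^sup>\<bottom>\<close>, on which \<open>K\<close> takes horizontal values, satisfies \<open>K(\<phi>X,\<phi>Y) = - K(X,Y)\<close> and, by polarization,
  vanishes as soon as all \<open>K(X,X)\<close> do.  This gives
  the explicit form of \<open>K\<close>, hence \<open>[K,K] = 0\<close>, and the statements on \<open>K(X,X)\<close> and \<open>K(X,\<phi>X)\<close>.
  The link with the curvatures is the identity
  \<open>g([K,K](X,\<phi>X)\<phi>X, X) = - 2 g(K(X,X), K(X,X))\<close> for horizontal \<open>X\<close>, in which the definiteness of \<open>g\<close> forces
  \<open>K(X,X) = 0\<close> when the left-hand side is zero; and \<open>S = R\<^sup>\<circ> + [K,K]\<close>, because the terms of first order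
  in \<open>K\<close> in the curvatures of \<open>\<nabla>\<^sup>\<circ> + K\<close> and \<open>\<nabla>\<^sup>\<circ> - K\<close> cancel.

  Passing between vector fields and tangent vectors needs two facts.  The value \<open>K(X,Y)(p)\<close> depends only on
  \<open>X(p)\<close> and \<open>Y(p)\<close>.  Indeed, total symmetry moves a field that vanishes at \<open>p\<close>
  into a slot of \<open>g\<close>, where it acts pointwise.  And every tangent vector is the value of a smooth
  vector field, constructed from a bump function in a chart; this takes some calculus of
  \<open>k\<close> times differentiable maps.
\<close>

section \<open>Calculus of maps of class \<open>C\<^sup>k\<close>\<close>

lemma Ck_on_has_derivative:
  "Ck_on (Suc k) S f \<Longrightarrow> x \<in> S \<Longrightarrow> (f has_derivative frechet_derivative f (at x)) (at x)"
  by (auto simp: frechet_derivative_works[symmetric])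

lemma Ck_on_frechet_derivative: 
  "Ck_on (Suc k) S f \<Longrightarrow> Ck_on k S (\<lambda>x. frechet_derivative f (at x) v)"
  by simp

lemma Ck_on_cong:
  assumes "open S" "\<And>x. x \<in> S \<Longrightarrow> f x = g x" "Ck_on k S f"
  shows "Ck_on k S g"
  using assms(2,3)
proof (induction k arbitrary: f g)
  case 0
  then show ?case by (simp cong: continuous_on_cong)
next
  case (Suc k)
  have der: "(g has_derivative frechet_derivative f (at x)) (at x)" if "x \<in> S" for x
    using Suc.prems that \<open>open S\<close>
    by (auto intro: has_derivative_transform_within_open[of f _ x UNIV S g]
        simp: frechet_derivative_works[symmetric])
  have eq: "frechet_derivative f (at x) v = frechet_derivative g (at x) v" if "x \<in> S" for x v
    using frechet_derivative_at[OF der[OF that]] by simp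
  have "Ck_on k S (\<lambda>x. frechet_derivative g (at x) v)" for v
    by (rule Suc.IH[OF eq Ck_on_frechet_derivative[OF Suc.prems(2)]])
  then show ?case
    using der unfolding Ck_on.simps differentiable_def by blast
qed

text \<open>A derivative that is known in closed form can replace the Frechet derivative operator
  of the definition; openness of the domain is what makes the change invisible to further derivatives.\<close>

lemma Ck_on_SucI:
  assumes "open S" "\<And>x. x \<in> S \<Longrightarrow> (f has_derivative f' x) (at x)"
    and "\<And>v. Ck_on k S (\<lambda>x. f' x v)"
  shows "Ck_on (Suc k) S f"
proof -
  have eq: "f' x = frechet_derivative f (at x)" if "x \<in> S" for x
    using frechet_derivative_at[OF assms(2)[OF that]] .
  have "Ck_on k S (\<lambda>x. frechet_derivative f (at x) v)" for v
    by (rule Ck_on_cong[OF assms(1) _ assms(3)[of v]]) (simp add: eq)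
  then show ?thesis
    using assms(2) by (auto simp: differentiable_def)
qed

lemma Ck_on_Suc_imp: "Ck_on (Suc k) S f \<Longrightarrow> Ck_on k S f"
proof (induction k arbitrary: f)
  case 0
  then show ?case
    by (auto intro!: differentiable_imp_continuous_on differentiable_at_imp_differentiable_on)
next
  case (Suc k)
  have "Ck_on k S (\<lambda>x. frechet_derivative f (at x) v)" for v
    using Suc.prems by (intro Suc.IH) simp
  then show ?case using Suc.prems by simp
qed

lemma Ck_on_Un:
  assumes "open S" "open T" "Ck_on k S f" "Ck_on k T f"
  shows "Ck_on k (S \<union> T) f"
  using assms(3,4)
proof (induction k arbitrary: f)
  case 0
  then show ?case by (simp add: continuous_on_open_Un assms(1,2))
next
  case (Suc k)
  have "Ck_on k (S \<union> T) (\<lambda>x. frechet_derivative f (at x) v)" for v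
    using Suc.prems by (intro Suc.IH) simp_all
  then show ?case using Suc.prems by auto
qed

lemma Ck_on_const: "Ck_on k S (\<lambda>x. c)"
  by (induction k arbitrary: c) auto

lemma Ck_on_linear_compose:
  assumes L: "bounded_linear L" and "open S" "Ck_on k S f"
  shows "Ck_on k S (\<lambda>x. L (f x))"
  using assms(3)
proof (induction k arbitrary: f)
  case 0
  then show ?case by (simp add: bounded_linear.continuous_on[OF L])
next
  case (Suc k)
  show ?case
    by (rule Ck_on_SucI[OF \<open>open S\<close>
          bounded_linear.has_derivative[OF L Ck_on_has_derivative[OF Suc.prems]]])
      (use Suc in auto)
qed

lemma Ck_on_add:
  assumes "open S" "Ck_on k S f" "Ck_on k S g"
  shows "Ck_on k S (\<lambda>x. f x + g x)"
  using assms(2,3)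
proof (induction k arbitrary: f g)
  case 0
  then show ?case by (simp add: continuous_on_add)
next
  case (Suc k)
  show ?case
    by (rule Ck_on_SucI[OF \<open>open S\<close> has_derivative_add[OF
            Ck_on_has_derivative[OF Suc.prems(1)] Ck_on_has_derivative[OF Suc.prems(2)]]])
      (use Suc in auto)
qed

lemma Ck_on_diff:
  assumes "open S" "Ck_on k S f" "Ck_on k S g"
  shows "Ck_on k S (\<lambda>x. f x - g x)"
proof -
  have "Ck_on k S (\<lambda>x. - g x)"
    by (rule Ck_on_linear_compose[OF bounded_linear_minus[OF bounded_linear_ident] assms(1,3)])
  from Ck_on_add[OF assms(1,2) this] show ?thesis by simp
qed

lemma Ck_on_sum:
  assumes "open S" "\<And>i. i \<in> I \<Longrightarrow> Ck_on k S (f i)"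
  shows "Ck_on k S (\<lambda>x. \<Sum>i\<in>I. f i x)"
  using assms(2)
  by (induction I rule: infinite_finite_induct) (auto intro: Ck_on_const Ck_on_add[OF assms(1)])

lemma Ck_on_bilinear:
  assumes B: "bounded_bilinear B" and "open S" "Ck_on k S f" "Ck_on k S g"
  shows "Ck_on k S (\<lambda>x. B (f x) (g x))"
  using assms(3,4)
proof (induction k arbitrary: f g)
  case 0
  then show ?case by (simp add: bounded_bilinear.continuous_on[OF B])
next
  case (Suc k)
  have "Ck_on k S (\<lambda>x. B (f x) (frechet_derivative g (at x) v) + B (frechet_derivative f (at x) v) (g x))"
    for v
    using Suc.prems[THEN Ck_on_frechet_derivative] Suc.prems[THEN Ck_on_Suc_imp]
    by (intro Ck_on_add[OF \<open>open S\<close>] Suc.IH)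
  then show ?case
    by (rule Ck_on_SucI[OF \<open>open S\<close> bounded_bilinear.FDERIV[OF B
            Ck_on_has_derivative[OF Suc.prems(1)] Ck_on_has_derivative[OF Suc.prems(2)]], rotated 2])
qed

text \<open>The derivative of \<open>f \<circ> g\<close> is not a composition of maps of one lower order, since
  the operator \<open>f'(g x)\<close> is applied to a vector that also depends on \<open>x\<close>.  Expanding that vector in the
  basis turns it into a sum of products of such compositions, to which the induction applies.\<close>

lemma Ck_on_compose:
  fixes g :: "'a::real_normed_vector \<Rightarrow> 'b::euclidean_space"
  assumes "open S" "open T" "Ck_on k S g" "g ` S \<subseteq> T" "Ck_on k T f"
  shows "Ck_on k S (\<lambda>x. f (g x))"
  using assms(3,5)
proof (induction k arbitrary: f)
  case 0
  then show ?case using assms(4) by (auto intro: continuous_on_compose2)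
next
  case (Suc k)
  let ?f' = "\<lambda>y. frechet_derivative f (at y)" and ?g' = "\<lambda>x. frechet_derivative g (at x)"
  have "(\<lambda>x. f (g x)) = f \<circ> g" by auto
  then have der: "((\<lambda>x. f (g x)) has_derivative (\<lambda>v. ?f' (g x) (?g' x v))) (at x)" if "x \<in> S" for x
    using diff_chain_at[OF Ck_on_has_derivative[OF Suc.prems(1) that]
        Ck_on_has_derivative[OF Suc.prems(2), of "g x"]] that assms(4)
    by (auto simp: o_def)
  have expand: "?f' (g x) (?g' x v) = (\<Sum>b\<in>Basis. (?g' x v \<bullet> b) *\<^sub>R ?f' (g x) b)" if "x \<in> S" for x v
  proof -
    interpret linear "?f' (g x)"
      using has_derivative_linear Ck_on_has_derivative[OF Suc.prems(2), of "g x"] that assms(4)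
      by blast
    have "?f' (g x) (?g' x v) = ?f' (g x) (\<Sum>b\<in>Basis. (?g' x v \<bullet> b) *\<^sub>R b)"
      by (simp add: euclidean_representation)
    then show ?thesis by (simp add: sum scale)
  qed
  have "Ck_on k S (\<lambda>x. \<Sum>b\<in>Basis. (?g' x v \<bullet> b) *\<^sub>R ?f' (g x) b)" for v
    using Suc.prems(2)
    by (intro Ck_on_sum Ck_on_bilinear[OF bounded_bilinear_scaleR] Suc.IH
        Ck_on_bilinear[OF bounded_bilinear_inner] Ck_on_const Ck_on_frechet_derivative[OF Suc.prems(1)]
        Ck_on_Suc_imp[OF Suc.prems(1)] assms(1)) simp_all
  then have "Ck_on k S (\<lambda>x. ?f' (g x) (?g' x v))" for v
    by (rule Ck_on_cong[OF assms(1), rotated]) (simp add: expand)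
  then show ?case
    by (rule Ck_on_SucI[OF assms(1) der, rotated])
qed


section \<open>Bump functions\<close>

text \<open>These functions for all \<open>n\<close> together are closed under differentiation up to linear
  combinations, so that all orders of smoothness of \<open>exp(-1/t)\<close>, extended by zero, come out of one induction.\<close>

definition flat_exp :: "nat \<Rightarrow> real \<Rightarrow> real" where
  "flat_exp n t = (if t > 0 then inverse t ^ n * exp (- inverse t) else 0)"

lemma flat_exp_tendsto_0: "(flat_exp n \<longlongrightarrow> 0) (at 0)"
proof -
  have "((\<lambda>t. inverse t ^ n / exp (inverse t)) \<longlongrightarrow> 0) (at_right (0::real))"
    using filterlim_compose[OF tendsto_power_div_exp_0[of n] filterlim_inverse_at_top_right] .
  then have "(flat_exp n \<longlongrightarrow> 0) (at_right 0)"
    by (rule Lim_transform_eventually)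
      (auto simp: flat_exp_def eventually_at_filter exp_minus divide_inverse)
  moreover have "(flat_exp n \<longlongrightarrow> 0) (at_left 0)"
    by (rule tendsto_eventually) (auto simp: flat_exp_def eventually_at_filter)
  ultimately show ?thesis by (simp add: filterlim_at_split)
qed

lemma flat_exp_has_derivative:
  "(flat_exp n has_real_derivative (flat_exp (n + 2) t - real n * flat_exp (n + 1) t)) (at t)"
proof -
  consider "t > 0" | "t < 0" | "t = 0" by linarith
  then show ?thesis
  proof cases
    case 1
    let ?u = "inverse t"
    have "((\<lambda>t. inverse t ^ n * exp (- inverse t)) has_real_derivative
        real n * ?u ^ (n - 1) * (- (?u * ?u)) * exp (- ?u) + ?u ^ n * (exp (- ?u) * (?u * ?u))) (at t)"
      using 1 by (auto intro!: derivative_eq_intros simp: power2_eq_square)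
    also have "real n * ?u ^ (n - 1) * (- (?u * ?u)) * exp (- ?u) + ?u ^ n * (exp (- ?u) * (?u * ?u))
        = flat_exp (n + 2) t - real n * flat_exp (n + 1) t"
      using 1 by (cases n) (simp_all add: flat_exp_def algebra_simps)
    finally have "((\<lambda>t. inverse t ^ n * exp (- inverse t)) has_real_derivative
        flat_exp (n + 2) t - real n * flat_exp (n + 1) t) (at t)" .
    then show ?thesis
      by (rule has_field_derivative_transform_within_open[of _ _ _ "{0<..}"])
        (use 1 in \<open>auto simp: flat_exp_def\<close>)
  next
    case 2
    have "((\<lambda>t. 0) has_real_derivative (flat_exp (n + 2) t - real n * flat_exp (n + 1) t)) (at t)"
      using 2 by (simp add: flat_exp_def)
    then show ?thesis
      by (rule has_field_derivative_transform_within_open[of _ _ _ "{..<0}"])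
        (use 2 in \<open>auto simp: flat_exp_def\<close>)
  next
    case 3
    \<comment> \<open>At zero the difference quotient is again one of these functions.\<close>
    have "(\<lambda>h. (flat_exp n (0 + h) - flat_exp n 0) / h) = flat_exp (n + 1)"
      by (auto simp: flat_exp_def fun_eq_iff divide_inverse)
    then show ?thesis
      using flat_exp_tendsto_0[of "n + 1"] 3 by (simp add: DERIV_def flat_exp_def)
  qed
qed

lemma Ck_on_flat_exp: "Ck_on k UNIV (flat_exp n)"
proof (induction k arbitrary: n)
  case 0
  show ?case
    using flat_exp_has_derivative
    by (auto simp: continuous_on_eq_continuous_at intro: DERIV_isCont)
next
  case (Suc k)
  show ?case
    by (rule Ck_on_SucI[OF open_UNIV flat_exp_has_derivative[unfolded has_field_derivative_def]])
      (intro Ck_on_bilinear[OF bounded_bilinear_mult] Ck_on_diff Ck_on_const Suc open_UNIV)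
qed

text \<open>The function is \<open>exp(-1/t)\<close>, extended by zero, at
  \<open>t = r\<^sup>2 - \<bar>x - a\<bar>\<^sup>2\<close> and normalized at the centre.\<close>

lemma bump_function:
  fixes a :: "'a::euclidean_space"
  assumes "r > 0"
  shows "\<exists>\<beta>::'a \<Rightarrow> real. smooth_on UNIV \<beta> \<and> \<beta> a = 1 \<and> (\<forall>x. x \<notin> cball a r \<longrightarrow> \<beta> x = 0)"
proof -
  let ?\<beta> = "\<lambda>x. flat_exp 0 (r\<^sup>2 - (x - a) \<bullet> (x - a)) / exp (- inverse (r\<^sup>2))"
  have id: "Ck_on k UNIV (\<lambda>x::'a. x)" for k
    by (cases k) (auto intro: Ck_on_const)
  have "Ck_on k UNIV (\<lambda>x. flat_exp 0 (r\<^sup>2 - (x - a) \<bullet> (x - a)))" for k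
    by (rule Ck_on_compose[OF _ _ _ _ Ck_on_flat_exp])
      (auto intro!: Ck_on_diff Ck_on_bilinear[OF bounded_bilinear_inner] Ck_on_const id)
  then have "smooth_on UNIV ?\<beta>"
    unfolding smooth_on_def
    by (auto intro!: Ck_on_linear_compose[OF bounded_linear_divide])
  moreover have "?\<beta> a = 1"
    using assms by (simp add: flat_exp_def)
  moreover have "?\<beta> x = 0" if "x \<notin> cball a r" for x
  proof -
    have "r\<^sup>2 \<le> (norm (x - a))\<^sup>2"
      using that assms by (intro power_mono) (auto simp: dist_norm norm_minus_commute)
    then show ?thesis by (simp add: flat_exp_def power2_norm_eq_inner)
  qed
  ultimately have "smooth_on UNIV ?\<beta> \<and> ?\<beta> a = 1 \<and> (\<forall>x. x \<notin> cball a r \<longrightarrow> ?\<beta> x = 0)"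
    by blast
  then show ?thesis by (rule exI[of _ ?\<beta>])
qed


section \<open>Extending tangent vectors to vector fields\<close>

lemma chart_inv_apply: "is_chart c \<Longrightarrow> q \<in> fst c \<Longrightarrow> chart_inv c (snd c q) = q"
  by (auto simp: is_chart_def homeomorphism_def)

lemma open_chart_image:
  assumes "is_chart c" "open U" "U \<subseteq> fst c"
  shows "open (snd c ` U)"
proof -
  have "openin (top_of_set (fst c)) U"
    using assms(2,3) by (simp add: open_subset)
  then have "openin (top_of_set (snd c ` fst c)) (snd c ` U)"
    using assms(1) homeomorphism_imp_open_map unfolding is_chart_def by blast
  then show ?thesis
    using assms(1) openin_open_trans unfolding is_chart_def by blast
qed

lemma tvec_eqI: "(\<And>c. components v c = components w c) \<Longrightarrow> v = w"
  by (simp add: components_inject[symmetric] fun_eq_iff)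

lemma components_add: "components (v + w) c = components v c + components w c"
  by (simp add: plus_tvec_def Tvec_inverse)

lemma components_diff: "components (v - w) c = components v c - components w c"
  by (simp add: minus_tvec_def Tvec_inverse)

lemma components_scaleR: "components (r *\<^sub>R v) c = r *\<^sub>R components v c"
  by (simp add: scaleR_tvec_def Tvec_inverse)

lemma components_zero: "components 0 c = 0"
  by (simp add: zero_tvec_def Tvec_inverse)

definition transition_deriv ::
    "('m, 'e::euclidean_space) chart \<Rightarrow> ('m, 'e) chart \<Rightarrow> 'm \<Rightarrow> 'e \<Rightarrow> 'e" where
  "transition_deriv c d q = frechet_derivative (snd d \<circ> chart_inv c) (at (snd c q))"

locale manifold =
  fixes A :: "('m::{t2_space,second_countable_topology}, 'e::euclidean_space) chart set"
  assumes atlas: "smooth_atlas A"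
begin

lemma chart: "c \<in> A \<Longrightarrow> is_chart c"
  using atlas by (simp add: smooth_atlas_def)

lemma open_domain: "c \<in> A \<Longrightarrow> open (fst c)"
  using chart unfolding is_chart_def by blast

lemma open_chart_range: "c \<in> A \<Longrightarrow> open (snd c ` fst c)"
  using chart unfolding is_chart_def by blast

lemma open_overlap: "c \<in> A \<Longrightarrow> d \<in> A \<Longrightarrow> open (snd c ` (fst c \<inter> fst d))"
  by (intro open_chart_image chart open_Int open_domain) auto

lemma transition_Ck:
  "c \<in> A \<Longrightarrow> d \<in> A \<Longrightarrow> Ck_on k (snd c ` (fst c \<inter> fst d)) (snd d \<circ> chart_inv c)"
  using atlas unfolding smooth_atlas_def smooth_on_def by blast

lemma transition_has_derivative:
  assumes "c \<in> A" "d \<in> A" "q \<in> fst c" "q \<in> fst d"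
  shows "((snd d \<circ> chart_inv c) has_derivative transition_deriv c d q) (at (snd c q))"
  unfolding transition_deriv_def
  by (rule Ck_on_has_derivative[OF transition_Ck[of c d 1, unfolded One_nat_def]]) (use assms in auto)

lemma linear_transition_deriv:
  assumes "c \<in> A" "d \<in> A" "q \<in> fst c" "q \<in> fst d"
  shows "linear (transition_deriv c d q)"
  using has_derivative_linear[OF transition_has_derivative[OF assms]] .

text \<open>The chain rule; it makes the transformation law of tangent vectors consistent.\<close>

lemma transition_deriv_cocycle:
  assumes "c \<in> A" "d \<in> A" "e \<in> A" "q \<in> fst c" "q \<in> fst d" "q \<in> fst e"
  shows "transition_deriv d e q (transition_deriv c d q w) = transition_deriv c e q w"
proof -
  let ?U = "snd c ` (fst c \<inter> fst d \<inter> fst e)"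
  have q: "(snd d \<circ> chart_inv c) (snd c q) = snd d q"
    using assms by (simp add: chart_inv_apply chart)
  have "((snd e \<circ> chart_inv d) \<circ> (snd d \<circ> chart_inv c) has_derivative
      transition_deriv d e q \<circ> transition_deriv c d q) (at (snd c q))"
    by (rule diff_chain_at) (use assms q in \<open>auto intro: transition_has_derivative\<close>)
  then have "((snd e \<circ> chart_inv c) has_derivative
      transition_deriv d e q \<circ> transition_deriv c d q) (at (snd c q))"
  proof (rule has_derivative_transform_within_open)
    show "open ?U"
      using assms by (intro open_chart_image chart open_Int open_domain) auto
    show "snd c q \<in> ?U" using assms by auto
    show "((snd e \<circ> chart_inv d) \<circ> (snd d \<circ> chart_inv c)) y = (snd e \<circ> chart_inv c) y"
      if "y \<in> ?U" for y
      using that assms by (auto simp: chart_inv_apply chart)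
  qed
  from frechet_derivative_at[OF this] show ?thesis
    by (simp add: transition_deriv_def fun_eq_iff)
qed

lemma tangent_space_iff:
  "v \<in> tangent_space A p \<longleftrightarrow>
     (\<forall>c. \<not> (c \<in> A \<and> p \<in> fst c) \<longrightarrow> components v c = 0) \<and>
     (\<forall>c\<in>A. \<forall>d\<in>A. p \<in> fst c \<longrightarrow> p \<in> fst d \<longrightarrow>
        components v d = transition_deriv c d p (components v c))"
  unfolding tangent_space_def transition_deriv_def mem_Collect_eq Int_iff by blast

lemma subspace_tangent_space: "subspace (tangent_space A p)"
proof (rule subspaceI)
  have outside: "components v c = 0" if "v \<in> tangent_space A p" "\<not> (c \<in> A \<and> p \<in> fst c)" for v c
    using that unfolding tangent_space_iff by blast
  have change: "components v d = transition_deriv c d p (components v c)"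
    if "v \<in> tangent_space A p" "c \<in> A" "d \<in> A" "p \<in> fst c" "p \<in> fst d" for v c d
    using that unfolding tangent_space_iff by blast
  note lin = linear_0[OF linear_transition_deriv] linear_add[OF linear_transition_deriv]
    linear_scale[OF linear_transition_deriv]
  show "0 \<in> tangent_space A p"
    by (simp add: tangent_space_iff components_zero lin)
  fix v assume v: "v \<in> tangent_space A p"
  show "r *\<^sub>R v \<in> tangent_space A p" for r
    unfolding tangent_space_iff
    by (intro conjI allI ballI impI)
      (simp_all add: components_scaleR lin outside[OF v] change[OF v, symmetric])
  fix w assume w: "w \<in> tangent_space A p"
  show "v + w \<in> tangent_space A p"
    unfolding tangent_space_iff
    by (intro conjI allI ballI impI)
      (simp_all add: components_add lin outside[OF v] outside[OF w]
        change[OF v, symmetric] change[OF w, symmetric])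
qed

lemma vector_field_tangent: "X \<in> vector_fields A \<Longrightarrow> X p \<in> tangent_space A p"
  by (simp add: vector_fields_def)

lemma vector_field_diff:
  assumes "X \<in> vector_fields A" "Y \<in> vector_fields A"
  shows "(\<lambda>p. X p - Y p) \<in> vector_fields A"
  using assms
  by (simp add: vector_fields_def components_diff smooth_on_def Ck_on_diff open_chart_range
      subspace_diff[OF subspace_tangent_space])

text \<open>In a chart around \<open>p\<close> take the constant field with the components of \<open>v\<close> and multiply
  it by a bump function that vanishes outside a closed ball in the chart.  The ball is compact in the manifold,
  hence closed because the manifold is Hausdorff, so the extension by zero is smooth.\<close>

lemma vector_field_exists:
  assumes v: "v \<in> tangent_space A p"
  obtains X where "X \<in> vector_fields A" "X p = v"
proof -
  obtain c where c: "c \<in> A" "p \<in> fst c"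
    using atlas unfolding smooth_atlas_def by blast
  note chc = chart[OF c(1)]
  have "open (snd c ` fst c)" "snd c p \<in> snd c ` fst c"
    using c chc by (auto simp: is_chart_def)
  then obtain r where r: "r > 0" "cball (snd c p) r \<subseteq> snd c ` fst c"
    by (meson open_contains_cball)
  obtain \<beta> :: "'e \<Rightarrow> real"
    where \<beta>: "smooth_on UNIV \<beta>" "\<beta> (snd c p) = 1" "\<And>x. x \<notin> cball (snd c p) r \<Longrightarrow> \<beta> x = 0"
    using bump_function[OF r(1), of "snd c p"] by blast
  define w where "w = components v c"
  define B where "B = chart_inv c ` cball (snd c p) r"
  have "compact B"
    unfolding B_def using chc r(2)
    by (intro compact_continuous_image)
      (auto simp: is_chart_def homeomorphism_def intro: continuous_on_subset)
  then have B: "closed B" by (rule compact_imp_closed)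
  have \<beta>0: "\<beta> (snd c q) = 0" if "q \<in> fst c" "q \<notin> B" for q
    using \<beta>(3)[of "snd c q"] that chart_inv_apply[OF chc that(1)] imageI[of "snd c q" _ "chart_inv c"]
    unfolding B_def by metis
  define X where "X q = Tvec (\<lambda>d. if d \<in> A \<and> q \<in> fst d \<and> q \<in> fst c
    then \<beta> (snd c q) *\<^sub>R transition_deriv c d q w else 0)" for q
  have comp: "components (X q) d = (if d \<in> A \<and> q \<in> fst d \<and> q \<in> fst c
      then \<beta> (snd c q) *\<^sub>R transition_deriv c d q w else 0)" for q d
    by (simp add: X_def Tvec_inverse)
  have "X q \<in> tangent_space A q" for q
    using c(1)
    by (simp add: tangent_space_iff comp linear_0[OF linear_transition_deriv]
        linear_scale[OF linear_transition_deriv] transition_deriv_cocycle)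
  moreover have "Ck_on k (snd d ` fst d) (\<lambda>x. components (X (chart_inv d x)) d)" if d: "d \<in> A" for d k
  proof -
    let ?F = "\<lambda>x. components (X (chart_inv d x)) d"
    \<comment> \<open>The two sets cover the chart \<open>d\<close>; the field vanishes on \<open>?V\<close>.\<close>
    let ?U = "snd d ` (fst d \<inter> fst c)" and ?V = "snd d ` (fst d - B)"
    let ?\<tau> = "snd c \<circ> chart_inv d"
    note chd = chart[OF d]
    have oU: "open ?U" using open_overlap d c by blast
    have oV: "open ?V"
      using open_domain[OF d] B by (intro open_chart_image chd) auto
    have U: "Ck_on k ?U ?F"
    proof (rule Ck_on_cong[OF oU])
      have "Ck_on k ?U (\<lambda>x. \<beta> (?\<tau> x))"
        by (rule Ck_on_compose[OF oU open_UNIV transition_Ck])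
          (use \<beta>(1) d c in \<open>auto simp: smooth_on_def\<close>)
      moreover have "Ck_on k ?U (\<lambda>x. frechet_derivative (snd d \<circ> chart_inv c) (at (?\<tau> x)) w)"
      proof (rule Ck_on_compose[OF oU _ transition_Ck])
        show "open (snd c ` (fst c \<inter> fst d))" using open_overlap d c by blast
        show "?\<tau> ` ?U \<subseteq> snd c ` (fst c \<inter> fst d)"
          using chart_inv_apply[OF chd] by auto
        show "Ck_on k (snd c ` (fst c \<inter> fst d))
            (\<lambda>y. frechet_derivative (snd d \<circ> chart_inv c) (at y) w)"
          by (rule Ck_on_frechet_derivative[OF transition_Ck[OF c(1) d]])
      qed (use d c in auto)
      ultimately show "Ck_on k ?U (\<lambda>x. \<beta> (?\<tau> x) *\<^sub>R
          frechet_derivative (snd d \<circ> chart_inv c) (at (?\<tau> x)) w)"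
        by (rule Ck_on_bilinear[OF bounded_bilinear_scaleR oU])
    qed (use d chart_inv_apply[OF chd] in \<open>auto simp: comp transition_deriv_def\<close>)
    have V: "Ck_on k ?V ?F"
      by (rule Ck_on_cong[OF oV _ Ck_on_const[of _ _ 0]])
        (use chart_inv_apply[OF chd] \<beta>0 in \<open>auto simp: comp\<close>)
    have "B \<subseteq> fst c"
      using r(2) chart_inv_apply[OF chc] by (auto simp: B_def)
    then have "snd d ` fst d = ?U \<union> ?V" by blast
    with Ck_on_Un[OF oU oV U V] show ?thesis by simp
  qed
  ultimately have "X \<in> vector_fields A"
    by (simp add: vector_fields_def smooth_on_def)
  moreover have "X p = v"
  proof (rule tvec_eqI)
    fix d
    show "components (X p) d = components v d"
    proof (cases "d \<in> A \<and> p \<in> fst d")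
      case True
      then have "components v d = transition_deriv c d p w"
        using v c unfolding tangent_space_iff w_def by blast
      with True show ?thesis by (simp add: comp c \<beta>(2))
    next
      case False
      then have "components v d = 0"
        using v unfolding tangent_space_iff by blast
      with False show ?thesis by (auto simp: comp)
    qed
  qed
  ultimately show thesis by (rule that)
qed

lemma extension:
  assumes "v \<in> tangent_space A p"
  shows "extension A p v \<in> vector_fields A" "extension A p v p = v"
proof -
  have "\<exists>X. X \<in> vector_fields A \<and> X p = v"
    using vector_field_exists[OF assms] by blast
  from someI_ex[OF this] show "extension A p v \<in> vector_fields A" "extension A p v p = v"
    by (auto simp: extension_def)
qed

end


section \<open>The algebra of a single tangent space\<close>

text \<open>The structure which an almost contact statistical manifold induces on a single
  tangent space.  The carrier is a subspace because tangent spaces are subspaces of one vector space.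
  Bilinearity of \<open>K\<close> is a consequence of the symmetry of \<open>g(K(u,v),w)\<close>.\<close>

locale almost_contact_statistical_space =
  fixes V :: "'v::real_vector set" and \<phi> :: "'v \<Rightarrow> 'v" and \<xi> :: 'v and \<eta> :: "'v \<Rightarrow> real"
    and g :: "'v \<Rightarrow> 'v \<Rightarrow> real" and K :: "'v \<Rightarrow> 'v \<Rightarrow> 'v"
  assumes subspace: "subspace V"
    and phi_linear: "linear_on V \<phi>" and phi_in: "v \<in> V \<Longrightarrow> \<phi> v \<in> V"
    and xi_in: "\<xi> \<in> V" and eta_linear: "linear_on V \<eta>"
    and g_linear: "v \<in> V \<Longrightarrow> linear_on V (g v)"
    and g_sym: "v \<in> V \<Longrightarrow> w \<in> V \<Longrightarrow> g v w = g w v"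
    and g_pos: "v \<in> V \<Longrightarrow> v \<noteq> 0 \<Longrightarrow> g v v > 0"
    and phi_phi: "v \<in> V \<Longrightarrow> \<phi> (\<phi> v) = - v + \<eta> v *\<^sub>R \<xi>"
    and eta_xi: "\<eta> \<xi> = 1"
    and g_phi: "v \<in> V \<Longrightarrow> w \<in> V \<Longrightarrow> g (\<phi> v) (\<phi> w) = g v w - \<eta> v * \<eta> w"
    and K_in: "v \<in> V \<Longrightarrow> w \<in> V \<Longrightarrow> K v w \<in> V"
    and K_sym: "v \<in> V \<Longrightarrow> w \<in> V \<Longrightarrow> K v w = K w v"
    and K_cubic: "u \<in> V \<Longrightarrow> v \<in> V \<Longrightarrow> w \<in> V \<Longrightarrow> g (K u v) w = g (K u w) v"
    and K_phi: "v \<in> V \<Longrightarrow> w \<in> V \<Longrightarrow> K v (\<phi> w) = - \<phi> (K v w)"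
begin

lemmas closed [simp] = phi_in xi_in K_in subspace_add[OF subspace] subspace_diff[OF subspace]
  subspace_neg[OF subspace] subspace_scale[OF subspace] subspace_0[OF subspace]

lemma phi_add: "v \<in> V \<Longrightarrow> w \<in> V \<Longrightarrow> \<phi> (v + w) = \<phi> v + \<phi> w"
  and phi_scale: "v \<in> V \<Longrightarrow> \<phi> (r *\<^sub>R v) = r *\<^sub>R \<phi> v"
  using phi_linear by (auto simp: linear_on_def)

lemma eta_add: "v \<in> V \<Longrightarrow> w \<in> V \<Longrightarrow> \<eta> (v + w) = \<eta> v + \<eta> w"
  and eta_scale: "v \<in> V \<Longrightarrow> \<eta> (r *\<^sub>R v) = r * \<eta> v"
  using eta_linear by (auto simp: linear_on_def)

lemma g_add_right: "u \<in> V \<Longrightarrow> v \<in> V \<Longrightarrow> w \<in> V \<Longrightarrow> g u (v + w) = g u v + g u w"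
  and g_scale_right: "u \<in> V \<Longrightarrow> v \<in> V \<Longrightarrow> g u (r *\<^sub>R v) = r * g u v"
  using g_linear by (auto simp: linear_on_def)

lemma phi_0: "\<phi> 0 = 0"
  using phi_scale[of 0 0] by simp

lemma phi_minus: "v \<in> V \<Longrightarrow> \<phi> (- v) = - \<phi> v"
  using phi_scale[of v "-1"] by simp

lemma phi_diff: "v \<in> V \<Longrightarrow> w \<in> V \<Longrightarrow> \<phi> (v - w) = \<phi> v - \<phi> w"
  using phi_add[of v "- w"] by (simp add: phi_minus)

lemma g_add_left: "u \<in> V \<Longrightarrow> v \<in> V \<Longrightarrow> w \<in> V \<Longrightarrow> g (u + v) w = g u w + g v w"
  by (simp add: g_sym[of _ w] g_add_right)

lemma g_scale_left: "u \<in> V \<Longrightarrow> w \<in> V \<Longrightarrow> g (r *\<^sub>R u) w = r * g u w"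
  by (simp add: g_sym[of _ w] g_scale_right)

lemma g_minus_right: "u \<in> V \<Longrightarrow> v \<in> V \<Longrightarrow> g u (- v) = - g u v"
  using g_scale_right[of u v "-1"] by simp

lemma g_minus_left: "u \<in> V \<Longrightarrow> v \<in> V \<Longrightarrow> g (- u) v = - g u v"
  using g_scale_left[of u v "-1"] by simp

lemma g_zero_right: "u \<in> V \<Longrightarrow> g u 0 = 0"
  using g_scale_right[of u 0 0] by simp

lemma g_zero_left: "u \<in> V \<Longrightarrow> g 0 u = 0"
  using g_scale_left[of 0 u 0] by simp

lemma g_diff_left: "u \<in> V \<Longrightarrow> v \<in> V \<Longrightarrow> w \<in> V \<Longrightarrow> g (u - v) w = g u w - g v w"
  using g_add_left[of u "- v" w] by (simp add: g_minus_left)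

lemma g_diff_right: "u \<in> V \<Longrightarrow> v \<in> V \<Longrightarrow> w \<in> V \<Longrightarrow> g u (v - w) = g u v - g u w"
  using g_add_right[of u v "- w"] by (simp add: g_minus_right)

lemma g_nondegenerate:
  assumes "u \<in> V" "v \<in> V" "\<And>w. w \<in> V \<Longrightarrow> g u w = g v w"
  shows "u = v"
proof (rule ccontr)
  assume "u \<noteq> v"
  then have "g (u - v) (u - v) > 0"
    using g_pos[of "u - v"] assms by simp
  then show False
    using assms(1,2) assms(3)[of "u - v"] by (simp add: g_diff_left)
qed

lemma xi_nonzero: "\<xi> \<noteq> 0"
  using eta_xi eta_scale[of 0 0] by auto

text \<open>As \<open>\<phi>\<^sup>2 \<xi> = 0\<close>, applying \<open>\<phi>\<^sup>2\<close> to \<open>\<phi> \<xi>\<close> shows that \<open>\<phi> \<xi>\<close> is a multiple \<open>a \<xi>\<close>;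
  then \<open>a\<^sup>2 \<xi> = \<phi>\<^sup>2 \<xi> = 0\<close>.\<close>

lemma phi_xi: "\<phi> \<xi> = 0"
proof -
  have "\<phi> (\<phi> \<xi>) = 0" using phi_phi[of \<xi>] eta_xi by simp
  moreover from this have "\<phi> \<xi> = \<eta> (\<phi> \<xi>) *\<^sub>R \<xi>"
    using phi_phi[of "\<phi> \<xi>"] phi_0 by simp
  ultimately have "\<eta> (\<phi> \<xi>) *\<^sub>R \<phi> \<xi> = 0"
    using phi_scale[of \<xi> "\<eta> (\<phi> \<xi>)"] by simp
  with \<open>\<phi> \<xi> = \<eta> (\<phi> \<xi>) *\<^sub>R \<xi>\<close> show ?thesis by auto
qed

text \<open>Compute \<open>\<phi>\<^sup>3 v\<close> in two ways.\<close>

lemma eta_phi: "v \<in> V \<Longrightarrow> \<eta> (\<phi> v) = 0"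
proof -
  assume v: "v \<in> V"
  have "- \<phi> v + \<eta> (\<phi> v) *\<^sub>R \<xi> = \<phi> (- v + \<eta> v *\<^sub>R \<xi>)"
    using phi_phi[of "\<phi> v"] v by (simp add: phi_phi)
  also have "\<dots> = - \<phi> v"
    using v by (simp add: phi_diff phi_scale phi_xi)
  finally show ?thesis using xi_nonzero by simp
qed

lemma g_xi: "v \<in> V \<Longrightarrow> g v \<xi> = \<eta> v"
  using g_phi[of v \<xi>] by (simp add: phi_xi eta_xi g_zero_right)

text \<open>The compatibility of \<open>g\<close> with \<open>\<phi>\<close>, applied to \<open>v\<close> and \<open>\<phi> v\<close>, makes \<open>g(v, \<phi> v)\<close>
  equal to its own negative.\<close>

lemma g_phi_self: "v \<in> V \<Longrightarrow> g v (\<phi> v) = 0"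
proof -
  assume v: "v \<in> V"
  have "g (\<phi> v) (\<phi> (\<phi> v)) = g v (\<phi> v)"
    using v by (simp add: g_phi eta_phi)
  moreover have "g (\<phi> v) (\<phi> (\<phi> v)) = - g v (\<phi> v)"
    using v by (simp add: phi_phi g_diff_right g_scale_right g_xi eta_phi g_sym[of "\<phi> v" v])
  ultimately show ?thesis by simp
qed

lemma phi_eq_0_iff: "v \<in> V \<Longrightarrow> \<phi> v = 0 \<longleftrightarrow> v = \<eta> v *\<^sub>R \<xi>"
proof -
  assume v: "v \<in> V"
  show ?thesis
  proof
    assume "\<phi> v = 0"
    then show "v = \<eta> v *\<^sub>R \<xi>" using phi_phi[OF v] phi_0 by simp
  next
    assume "v = \<eta> v *\<^sub>R \<xi>"
    then have "\<phi> v = \<eta> v *\<^sub>R \<phi> \<xi>" using phi_scale[of \<xi> "\<eta> v"] by simp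
    then show "\<phi> v = 0" by (simp add: phi_xi)
  qed
qed

lemma phi_eq_0_iff_parallel: "v \<in> V \<Longrightarrow> \<phi> v = 0 \<longleftrightarrow> (\<exists>c. v = c *\<^sub>R \<xi>)"
  using phi_eq_0_iff phi_scale[of \<xi>] phi_xi by (metis scaleR_zero_right xi_in)

text \<open>For a nonzero horizontal \<open>v\<close> the vector \<open>\<phi> v\<close> is nonzero and orthogonal to \<open>v\<close>.\<close>

lemma dim_phi_section:
  assumes v: "v \<in> V" "g v \<xi> = 0"
  shows "dim (span {v, \<phi> v}) = 2 \<longleftrightarrow> v \<noteq> 0"
proof
  assume "dim (span {v, \<phi> v}) = 2"
  then show "v \<noteq> 0" using dim_le_card'[of "{0::'v}"] by (auto simp: phi_0)
next
  assume "v \<noteq> 0"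
  have "v \<notin> span {\<phi> v}"
  proof
    assume "v \<in> span {\<phi> v}"
    then obtain k where "v = k *\<^sub>R \<phi> v" by (auto simp: span_singleton)
    then have "g v v = k * g v (\<phi> v)" using v g_scale_right[of v "\<phi> v" k] by simp
    then show False using g_pos[OF v(1) \<open>v \<noteq> 0\<close>] g_phi_self[OF v(1)] by simp
  qed
  moreover have "\<phi> v \<noteq> 0"
    using phi_phi[OF v(1)] v g_xi[OF v(1)] \<open>v \<noteq> 0\<close> phi_0 by auto
  ultimately have "independent {v, \<phi> v}" "v \<noteq> \<phi> v"
    by (auto simp: independent_insert span_base)
  then show "dim (span {v, \<phi> v}) = 2"
    by (simp add: dim_eq_card_independent)
qed

lemma phi_section_area_pos:
  assumes "v \<in> V" "g v \<xi> = 0" "v \<noteq> 0"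
  shows "g v v * g (\<phi> v) (\<phi> v) - (g v (\<phi> v))\<^sup>2 > 0"
  using assms g_pos[of v] by (simp add: g_phi g_phi_self g_xi)

text \<open>By total symmetry \<open>g(K(u,v),z) = g(K(u,z),v)\<close> is linear in \<open>v\<close>, and \<open>g\<close> is
  nondegenerate.\<close>

lemma K_add_right:
  assumes "u \<in> V" "v \<in> V" "w \<in> V"
  shows "K u (v + w) = K u v + K u w"
proof (rule g_nondegenerate)
  fix z assume "z \<in> V"
  with assms show "g (K u (v + w)) z = g (K u v + K u w) z"
    using K_cubic[of u "v + w" z] K_cubic[of u v z] K_cubic[of u w z]
    by (simp add: g_add_left g_add_right)
qed (use assms in simp_all)

lemma K_scale_right:
  assumes "u \<in> V" "v \<in> V"
  shows "K u (r *\<^sub>R v) = r *\<^sub>R K u v"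
proof (rule g_nondegenerate)
  fix z assume "z \<in> V"
  with assms show "g (K u (r *\<^sub>R v)) z = g (r *\<^sub>R K u v) z"
    using K_cubic[of u "r *\<^sub>R v" z] K_cubic[of u v z]
    by (simp add: g_scale_left g_scale_right)
qed (use assms in simp_all)

text \<open>The vector \<open>K(v,\<xi>)\<close> is parallel to \<open>\<xi>\<close> because \<open>\<phi> K(v,\<xi>) = - K(v,\<phi> \<xi>) = 0\<close>.
  Its coefficient \<open>g(K(v,\<xi>),\<xi>)\<close> equals \<open>g(K(\<xi>,\<xi>),v)\<close>, where \<open>K(\<xi>,\<xi>)\<close> is parallel to \<open>\<xi>\<close> as well.\<close>

lemma K_xi: 
  assumes "v \<in> V"
  shows "K v \<xi> = (g (K \<xi> \<xi>) \<xi> * \<eta> v) *\<^sub>R \<xi>"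
proof -
  have par: "K u \<xi> = \<eta> (K u \<xi>) *\<^sub>R \<xi>" if "u \<in> V" for u
  proof -
    have "K u 0 = 0" using K_scale_right[of u 0 0] that by simp
    then have "\<phi> (K u \<xi>) = 0" using K_phi[of u \<xi>] that by (simp add: phi_xi)
    then show ?thesis using phi_eq_0_iff[OF K_in[OF that xi_in]] by blast
  qed
  have "\<eta> (K v \<xi>) = g (K \<xi> \<xi>) v"
    using assms K_cubic[of \<xi> v \<xi>] by (simp add: g_xi[symmetric] K_sym[of v \<xi>])
  also have "\<dots> = g (\<eta> (K \<xi> \<xi>) *\<^sub>R \<xi>) v"
    by (rule arg_cong[OF par[OF xi_in], of "\<lambda>x. g x v"])
  also have "\<dots> = g (K \<xi> \<xi>) \<xi> * \<eta> v"
    using assms by (simp add: g_scale_left g_sym[of \<xi> v] g_xi)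
  finally have "\<eta> (K v \<xi>) = g (K \<xi> \<xi>) \<xi> * \<eta> v" .
  with par[OF assms] show ?thesis by metis
qed

text \<open>The condition to which all the others are reduced.  By polarization it says that \<open>K\<close>
  vanishes on all pairs of horizontal vectors.\<close>

definition K_horizontal_zero :: bool where
  "K_horizontal_zero \<longleftrightarrow> (\<forall>v\<in>V. g v \<xi> = 0 \<longrightarrow> K v v = 0)"

lemma eta_K: 
  assumes "v \<in> V" "w \<in> V" "\<eta> v = 0"
  shows "\<eta> (K v w) = 0"
proof -
  have "g (K v w) \<xi> = g (K v \<xi>) w" using assms K_cubic[of v w \<xi>] by simp
  also have "K v \<xi> = 0" using assms K_xi[of v] by simp
  finally show ?thesis using assms by (simp add: g_xi g_zero_left)
qed

text \<open>Anticommutation with \<open>\<phi>\<close> in both arguments of \<open>K\<close> and \<open>\<phi>\<^sup>2 = - I\<close> on horizontal vectors give, for horizontal \<open>v\<close>,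
  \<open>K(\<phi> v, \<phi> u) = - K(v,u)\<close>.  With \<open>w = K(v,v)\<close> both terms of the bracket then contribute \<open>- K(v,w)\<close>, and
  \<open>g(K(v,w),v) = g(w,w)\<close>.\<close>

lemma K_bracket_phi_section:
  assumes v: "v \<in> V" "g v \<xi> = 0"
  shows "g (K v (K (\<phi> v) (\<phi> v)) - K (\<phi> v) (K v (\<phi> v))) v = - 2 * g (K v v) (K v v)"
proof -
  let ?w = "K v v"
  have w: "?w \<in> V" "\<eta> ?w = 0" "\<eta> v = 0"
    using v eta_K[of v v] by (auto simp: g_xi)
  have phi2: "\<phi> (\<phi> (K v u)) = - K v u" if "u \<in> V" for u
    using v w that by (simp add: phi_phi eta_K)
  have K2: "K (\<phi> v) (\<phi> u) = - K v u" if "u \<in> V" for u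
    using that v by (simp add: K_phi K_sym[of "\<phi> v" u] K_sym[of u v] phi_minus phi2)
  have "K v (- ?w) = - K v ?w"
    using K_scale_right[of v ?w "-1"] v by simp
  moreover have "K (\<phi> v) (- \<phi> ?w) = K v ?w"
    using K_scale_right[of "\<phi> v" "\<phi> ?w" "-1"] v K2[of ?w] by simp
  ultimately have "K v (K (\<phi> v) (\<phi> v)) - K (\<phi> v) (K v (\<phi> v)) = (- 2) *\<^sub>R K v ?w"
    using v K2[of v] K_phi[of v v] by (simp add: scaleR_2)
  moreover have "g (K v ?w) v = g ?w ?w"
    using v K_cubic[of v ?w v] by simp
  ultimately show ?thesis
    using v g_scale_left[of "K v ?w" v "-2"] by simp
qed

lemma K_horizontal_zero_iff_phi_sectional:
  "K_horizontal_zero \<longleftrightarrow> (\<forall>v\<in>V. g v \<xi> = 0 \<longrightarrow> v \<noteq> 0 \<longrightarrow>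
     g (K v (K (\<phi> v) (\<phi> v)) - K (\<phi> v) (K v (\<phi> v))) v
       / (g v v * g (\<phi> v) (\<phi> v) - (g v (\<phi> v))\<^sup>2) = 0)"
proof -
  have "K 0 0 = 0" using K_scale_right[of 0 0 0] by simp
  moreover have "(- 2 * g (K v v) (K v v) / (g v v * g (\<phi> v) (\<phi> v) - (g v (\<phi> v))\<^sup>2) = 0)
      \<longleftrightarrow> K v v = 0" if v: "v \<in> V" "g v \<xi> = 0" "v \<noteq> 0" for v
    using phi_section_area_pos[OF v] g_pos[of "K v v"] v(1)
    by (cases "K v v = 0") (auto simp: g_zero_left)
  ultimately show ?thesis
    unfolding K_horizontal_zero_def using K_bracket_phi_section by metis
qed

text \<open>Split both arguments into a horizontal part and a multiple of \<open>\<xi>\<close>: the horizontal parts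
  contribute nothing by polarization, and \<open>K(v,\<xi>)\<close> is known.\<close>

lemma K_horizontal_zero_iff_K_eq:
  "K_horizontal_zero \<longleftrightarrow> (\<forall>v\<in>V. \<forall>w\<in>V. K v w = (g (K \<xi> \<xi>) \<xi> * \<eta> v * \<eta> w) *\<^sub>R \<xi>)"
proof
  assume flat: K_horizontal_zero
  have horizontal: "K v w = 0" if vw: "v \<in> V" "w \<in> V" "\<eta> v = 0" "\<eta> w = 0" for v w
  proof -
    have "K (v + w) (v + w) = K v v + 2 *\<^sub>R K v w + K w w"
      using vw by (simp add: K_add_right K_sym[of "v + w"] K_sym[of w v] scaleR_2)
    moreover have "K (v + w) (v + w) = 0" "K v v = 0" "K w w = 0"
      using flat vw by (simp_all add: K_horizontal_zero_def g_xi eta_add)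
    ultimately show ?thesis by simp
  qed
  show "\<forall>v\<in>V. \<forall>w\<in>V. K v w = (g (K \<xi> \<xi>) \<xi> * \<eta> v * \<eta> w) *\<^sub>R \<xi>"
  proof (intro ballI)
    fix v w assume vw: "v \<in> V" "w \<in> V"
    \<comment> \<open>the horizontal parts of \<open>v\<close> and \<open>w\<close>\<close>
    define v' w' where "v' = v + (- \<eta> v) *\<^sub>R \<xi>" and "w' = w + (- \<eta> w) *\<^sub>R \<xi>"
    have eq: "v = v' + \<eta> v *\<^sub>R \<xi>" "w = w' + \<eta> w *\<^sub>R \<xi>"
      by (simp_all add: v'_def w'_def)
    have V: "v' \<in> V" "w' \<in> V" using vw by (simp_all add: v'_def w'_def del: scaleR_minus_left)
    have 0: "\<eta> v' = 0" "\<eta> w' = 0"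
      unfolding v'_def w'_def using vw by (simp_all add: eta_add eta_scale eta_xi del: scaleR_minus_left)
    have "K v w = K v w' + \<eta> w *\<^sub>R K v \<xi>"
      using vw V K_add_right[of v w' "\<eta> w *\<^sub>R \<xi>"] K_scale_right[of v \<xi> "\<eta> w"] eq(2) by simp
    also have "K v w' = K w' v' + \<eta> v *\<^sub>R K w' \<xi>"
      using vw V K_add_right[of w' v' "\<eta> v *\<^sub>R \<xi>"] K_scale_right[of w' \<xi> "\<eta> v"] eq(1)
        K_sym[of v w'] by simp
    also have "\<dots> = 0"
      using V 0 horizontal K_xi[of w'] by simp
    finally show "K v w = (g (K \<xi> \<xi>) \<xi> * \<eta> v * \<eta> w) *\<^sub>R \<xi>"
      using K_xi[OF vw(1)] by (simp add: mult_ac)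
  qed
next
  assume "\<forall>v\<in>V. \<forall>w\<in>V. K v w = (g (K \<xi> \<xi>) \<xi> * \<eta> v * \<eta> w) *\<^sub>R \<xi>"
  then have "K v v = (g (K \<xi> \<xi>) \<xi> * \<eta> v * \<eta> v) *\<^sub>R \<xi>" if "v \<in> V" for v
    using that by blast
  moreover have "(g (K \<xi> \<xi>) \<xi> * \<eta> v * \<eta> v) *\<^sub>R \<xi> = 0" if "v \<in> V" "g v \<xi> = 0" for v
    using that by (simp add: g_xi)
  ultimately show K_horizontal_zero unfolding K_horizontal_zero_def by metis
qed

text \<open>If \<open>\<phi> K(v,v) = 0\<close>, then \<open>K(v,v)\<close> is parallel to \<open>\<xi>\<close>; for horizontal \<open>v\<close> it is also
  orthogonal to \<open>\<xi>\<close>.\<close>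

lemma K_horizontal_zero_iff_phi_K: "K_horizontal_zero \<longleftrightarrow> (\<forall>v\<in>V. \<phi> (K v v) = 0)"
proof
  assume K_horizontal_zero
  then have "K v v = (g (K \<xi> \<xi>) \<xi> * \<eta> v * \<eta> v) *\<^sub>R \<xi>" if "v \<in> V" for v
    using that K_horizontal_zero_iff_K_eq by blast
  then show "\<forall>v\<in>V. \<phi> (K v v) = 0"
    using phi_eq_0_iff_parallel[OF K_in] by blast
next
  assume *: "\<forall>v\<in>V. \<phi> (K v v) = 0"
  show K_horizontal_zero
    unfolding K_horizontal_zero_def
  proof (intro ballI impI)
    fix v assume v: "v \<in> V" "g v \<xi> = 0"
    then have "\<eta> (K v v) = 0" using eta_K g_xi by simp
    moreover have "K v v = \<eta> (K v v) *\<^sub>R \<xi>"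
      using * v phi_eq_0_iff[OF K_in] by blast
    ultimately show "K v v = 0" by (metis scaleR_zero_left)
  qed
qed

text \<open>Both iterated products are the same multiple \<open>\<lambda>\<^sup>2 \<eta>(u) \<eta>(v) \<eta>(w)\<close> of \<open>\<xi>\<close>.\<close>

lemma K_horizontal_zero_imp_bracket:
  assumes K_horizontal_zero "u \<in> V" "v \<in> V" "w \<in> V"
  shows "K u (K v w) - K v (K u w) = 0"
proof -
  define l where "l = g (K \<xi> \<xi>) \<xi>"
  have "K a (K b c) = (l * l * \<eta> a * \<eta> b * \<eta> c) *\<^sub>R \<xi>"
    if "a \<in> V" "b \<in> V" "c \<in> V" for a b c
  proof -
    have "K b c = (l * \<eta> b * \<eta> c) *\<^sub>R \<xi>" "K a \<xi> = (l * \<eta> a) *\<^sub>R \<xi>"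
      using that assms(1) K_horizontal_zero_iff_K_eq K_xi unfolding l_def by blast+
    then show ?thesis
      using that K_scale_right[of a \<xi> "l * \<eta> b * \<eta> c"] by (simp add: mult_ac)
  qed
  from this[OF assms(2,3,4)] this[OF assms(3,2,4)] show ?thesis by (simp add: mult_ac)
qed

lemma K_horizontal_zero_imp_K_xi_xi:
  assumes K_horizontal_zero "v \<in> V" "w \<in> V"
  shows "K v w = (\<eta> v * \<eta> w) *\<^sub>R K \<xi> \<xi>"
proof -
  define l where "l = g (K \<xi> \<xi>) \<xi>"
  have "K v w = (l * \<eta> v * \<eta> w) *\<^sub>R \<xi>" "K \<xi> \<xi> = (l * \<eta> \<xi>) *\<^sub>R \<xi>"
    using assms K_horizontal_zero_iff_K_eq K_xi[OF xi_in] unfolding l_def by blast+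
  then show ?thesis by (simp add: eta_xi mult_ac)
qed

end


section \<open>The difference tensor and the curvatures\<close>

locale almost_contact_statistical = 
  fixes A :: "('m::{t2_space,second_countable_topology}, 'e::euclidean_space) chart set"
    and \<phi> :: "'m \<Rightarrow> ('m, 'e) tvec \<Rightarrow> ('m, 'e) tvec"
    and \<xi> :: "('m, 'e) vfield"
    and \<eta> :: "'m \<Rightarrow> ('m, 'e) tvec \<Rightarrow> real"
    and g :: "('m, 'e) metric"
    and nabla0 nabla :: "('m, 'e) connection"
  assumes manifold_structure: "almost_contact_statistical_manifold A \<phi> \<xi> \<eta> g nabla0 nabla"
begin

lemma contact: "almost_contact_metric_manifold A \<phi> \<xi> \<eta> g"
  and levi_civita: "levi_civita A g nabla0"
  and statistical: "statistical_structure A g nabla"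
  using manifold_structure unfolding almost_contact_statistical_manifold_def by blast+

sublocale manifold A
  using contact unfolding almost_contact_metric_manifold_def by unfold_locales blast

definition K :: "('m, 'e) connection" where
  "K = difference_tensor nabla nabla0"

lemma K_apply: "K X Y p = nabla X Y p - nabla0 X Y p"
  by (simp add: K_def difference_tensor_def)

lemma xi_field: "\<xi> \<in> vector_fields A"
  using contact unfolding almost_contact_metric_manifold_def by blast

lemma phi_field: "X \<in> vector_fields A \<Longrightarrow> (\<lambda>p. \<phi> p (X p)) \<in> vector_fields A"
  using contact unfolding almost_contact_metric_manifold_def endomorphism_field_def by blast

lemma affine: "affine_connection A nabla0" "affine_connection A nabla"
  using levi_civita statistical unfolding levi_civita_def statistical_structure_def by blast+

lemma torsion: "torsion_free A nabla0" "torsion_free A nabla"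
  using levi_civita statistical unfolding levi_civita_def statistical_structure_def by blast+

lemma connection_field:
  "affine_connection A D \<Longrightarrow> X \<in> vector_fields A \<Longrightarrow> Y \<in> vector_fields A \<Longrightarrow> D X Y \<in> vector_fields A"
  unfolding affine_connection_def by blast

lemma connection_add:
  "affine_connection A D \<Longrightarrow> X \<in> vector_fields A \<Longrightarrow> Y \<in> vector_fields A \<Longrightarrow> Z \<in> vector_fields A \<Longrightarrow>
    D X (\<lambda>p. Y p + Z p) = (\<lambda>p. D X Y p + D X Z p)"
  unfolding affine_connection_def by blast

lemma connection_diff:
  assumes "affine_connection A D"
    and "X \<in> vector_fields A" "Y \<in> vector_fields A" "Z \<in> vector_fields A"
  shows "D X (\<lambda>p. Y p - Z p) = (\<lambda>p. D X Y p - D X Z p)"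
  using connection_add[OF assms(1,2) vector_field_diff[OF assms(3,4)] assms(4)]
  by (simp add: fun_eq_iff)

lemma K_field: "X \<in> vector_fields A \<Longrightarrow> Y \<in> vector_fields A \<Longrightarrow> K X Y \<in> vector_fields A"
  using vector_field_diff[of "nabla X Y" "nabla0 X Y"] connection_field affine
  by (simp add: K_def difference_tensor_def)

lemma lie_bracket_field:
  assumes "X \<in> vector_fields A" "Y \<in> vector_fields A"
  shows "lie_bracket A X Y \<in> vector_fields A"
proof -
  have "(\<lambda>p. nabla0 X Y p - nabla0 Y X p) = lie_bracket A X Y"
    using torsion(1) assms unfolding torsion_free_def by blast
  then show ?thesis
    using vector_field_diff connection_field[OF affine(1)] assms by metis
qed

lemma K_sym:
  assumes "X \<in> vector_fields A" "Y \<in> vector_fields A"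
  shows "K X Y p = K Y X p"
proof -
  have "nabla X Y p - nabla Y X p = lie_bracket A X Y p"
    "nabla0 X Y p - nabla0 Y X p = lie_bracket A X Y p"
    using torsion assms unfolding torsion_free_def by (metis (no_types))+
  then show ?thesis by (simp add: K_apply algebra_simps)
qed

lemma metric: "riemannian_metric A g"
  using contact unfolding almost_contact_metric_manifold_def by blast

lemma metric_diff_left:
  assumes "u \<in> tangent_space A p" "v \<in> tangent_space A p" "w \<in> tangent_space A p"
  shows "g p (u - v) w = g p u w - g p v w"
proof -
  have lin: "g p w (x + y) = g p w x + g p w y"
    if "x \<in> tangent_space A p" "y \<in> tangent_space A p" for x y
    using metric assms that unfolding riemannian_metric_def linear_on_def by blast
  have sym: "g p x w = g p w x" if "x \<in> tangent_space A p" for x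
    using metric assms that unfolding riemannian_metric_def by blast
  have uv: "u - v \<in> tangent_space A p"
    using subspace_diff[OF subspace_tangent_space] assms by blast
  have "g p w u = g p w (u - v) + g p w v"
    using lin[OF uv assms(2)] by simp
  then show ?thesis
    using sym[OF uv] sym[OF assms(1)] sym[OF assms(2)] by simp
qed

text \<open>The metric is parallel for \<open>\<nabla>\<^sup>\<circ>\<close>, so
  \<open>(\<nabla>\<^sub>U g)(V,W) = - g(K(U,V),W) - g(K(U,W),V)\<close>.  The symmetry of the left-hand side and that of \<open>K\<close>
  give the total symmetry of \<open>g(K(U,V),W)\<close>.\<close>

lemma K_cubic:
  assumes X: "X \<in> vector_fields A" and Y: "Y \<in> vector_fields A" and Z: "Z \<in> vector_fields A"
  shows "g p (K X Y p) (Z p) = g p (K X Z p) (Y p)"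
proof -
  note fields = connection_field[OF affine(1)] connection_field[OF affine(2)] vector_field_tangent
  have sym: "g p (U p) (W p) = g p (W p) (U p)"
    if "U \<in> vector_fields A" "W \<in> vector_fields A" for U W
    using metric that vector_field_tangent unfolding riemannian_metric_def by blast
  have diff: "cov_deriv_metric A nabla g U V W p
      = - g p (K U V p) (W p) - g p (K U W p) (V p)"
    if UVW: "U \<in> vector_fields A" "V \<in> vector_fields A" "W \<in> vector_fields A" for U V W
  proof -
    have "cov_deriv_metric A nabla0 g U V W p = 0"
      using levi_civita UVW unfolding levi_civita_def by blast
    moreover have "g p (K U V p) (W p) = g p (nabla U V p) (W p) - g p (nabla0 U V p) (W p)"
      "g p (K U W p) (V p) = g p (nabla U W p) (V p) - g p (nabla0 U W p) (V p)"
      unfolding K_apply by (rule metric_diff_left; use UVW fields in blast)+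
    moreover have "g p (V p) (nabla U W p) = g p (nabla U W p) (V p)"
      "g p (V p) (nabla0 U W p) = g p (nabla0 U W p) (V p)"
      using sym[OF UVW(2) connection_field[OF affine(2) UVW(1,3)]]
        sym[OF UVW(2) connection_field[OF affine(1) UVW(1,3)]] .
    ultimately show ?thesis by (simp add: cov_deriv_metric_def)
  qed
  have "cov_deriv_metric A nabla g Y X Z p = cov_deriv_metric A nabla g X Y Z p"
    using statistical X Y Z unfolding statistical_structure_def by metis
  then have "g p (K Y Z p) (X p) = g p (K X Z p) (Y p)"
    using diff[OF X Y Z] diff[OF Y X Z] K_sym[OF X Y, of p] by simp
  moreover have "cov_deriv_metric A nabla g Y X Z p = cov_deriv_metric A nabla g Z X Y p"
    using statistical X Y Z unfolding statistical_structure_def by metis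
  then have "g p (K Y X p) (Z p) = g p (K Z X p) (Y p)"
    using diff[OF Y X Z] diff[OF Z X Y] K_sym[OF Y Z, of p] by simp
  ultimately show ?thesis using K_sym[OF X Y, of p] K_sym[OF X Z, of p] by simp
qed

text \<open>With \<open>Z = K(X,Y) - K(X,Y')\<close> one has \<open>g(Z,Z) = g(K(X,Z), Y - Y')\<close>, which is zero at \<open>p\<close>.\<close>

lemma K_local_right:
  assumes "X \<in> vector_fields A" "Y \<in> vector_fields A" "Y' \<in> vector_fields A" "Y p = Y' p"
  shows "K X Y p = K X Y' p"
proof (rule ccontr)
  let ?Z = "\<lambda>q. K X Y q - K X Y' q"
  have Z: "?Z \<in> vector_fields A"
    using vector_field_diff K_field assms by blast
  assume "K X Y p \<noteq> K X Y' p"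
  then have "g p (?Z p) (?Z p) > 0"
    using metric vector_field_tangent[OF Z] unfolding riemannian_metric_def by simp
  moreover have "g p (?Z p) (?Z p) = g p (K X Y p) (?Z p) - g p (K X Y' p) (?Z p)"
    by (rule metric_diff_left; intro vector_field_tangent K_field assms Z)
  moreover have "g p (K X Y p) (?Z p) = g p (K X ?Z p) (Y p)"
    "g p (K X Y' p) (?Z p) = g p (K X ?Z p) (Y' p)"
    by (intro K_cubic Z assms)+
  ultimately show False using assms(4) by simp
qed

lemma K_local:
  assumes "X \<in> vector_fields A" "Y \<in> vector_fields A" "X' \<in> vector_fields A" "Y' \<in> vector_fields A"
    and "X p = X' p" "Y p = Y' p"
  shows "K X Y p = K X' Y' p"
proof -
  have "K X Y p = K X Y' p" using K_local_right assms by blast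
  also have "\<dots> = K Y' X p" using K_sym assms by blast
  also have "\<dots> = K Y' X' p" using K_local_right assms by blast
  also have "\<dots> = K X' Y' p" using K_sym assms by blast
  finally show ?thesis .
qed

text \<open>The tensor \<open>K\<close> on tangent vectors; by the preceding lemma the choice of the extensions
  does not matter.\<close>

definition K_at :: "'m \<Rightarrow> ('m, 'e) tvec \<Rightarrow> ('m, 'e) tvec \<Rightarrow> ('m, 'e) tvec" where
  "K_at p u v = K (extension A p u) (extension A p v) p"

lemma K_eq_K_at:
  assumes "X \<in> vector_fields A" "Y \<in> vector_fields A"
  shows "K X Y p = K_at p (X p) (Y p)"
  unfolding K_at_def
  using assms by (intro K_local) (simp_all add: extension vector_field_tangent)

sublocale at: almost_contact_statistical_space "tangent_space A p" "\<phi> p" "\<xi> p" "\<eta> p" "g p" "K_at p" for p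
proof
  let ?T = "tangent_space A p"
  note ext = extension
  show "subspace ?T" by (rule subspace_tangent_space)
  show "linear_on ?T (\<phi> p)"
    using contact unfolding almost_contact_metric_manifold_def endomorphism_field_def by blast
  show "\<phi> p v \<in> ?T" if "v \<in> ?T" for v
    using contact that unfolding almost_contact_metric_manifold_def endomorphism_field_def by blast
  show "\<xi> p \<in> ?T" by (rule vector_field_tangent[OF xi_field])
  show "linear_on ?T (\<eta> p)"
    using contact unfolding almost_contact_metric_manifold_def one_form_def by blast
  show "linear_on ?T (g p v)" if "v \<in> ?T" for v
    using metric that unfolding riemannian_metric_def by blast
  show "g p v w = g p w v" if "v \<in> ?T" "w \<in> ?T" for v w
    using metric that unfolding riemannian_metric_def by blast
  show "g p v v > 0" if "v \<in> ?T" "v \<noteq> 0" for v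
    using metric that unfolding riemannian_metric_def by blast
  show "\<phi> p (\<phi> p v) = - v + \<eta> p v *\<^sub>R \<xi> p" if "v \<in> ?T" for v
    using contact that unfolding almost_contact_metric_manifold_def by blast
  show "\<eta> p (\<xi> p) = 1"
    using contact unfolding almost_contact_metric_manifold_def by blast
  show "g p (\<phi> p v) (\<phi> p w) = g p v w - \<eta> p v * \<eta> p w" if "v \<in> ?T" "w \<in> ?T" for v w
    using contact that unfolding almost_contact_metric_manifold_def by blast
  show "K_at p v w \<in> ?T" if "v \<in> ?T" "w \<in> ?T" for v w
    unfolding K_at_def by (intro vector_field_tangent K_field ext that)
  show "K_at p v w = K_at p w v" if "v \<in> ?T" "w \<in> ?T" for v w
    unfolding K_at_def by (intro K_sym ext that)
  show "g p (K_at p u v) w = g p (K_at p u w) v" if "u \<in> ?T" "v \<in> ?T" "w \<in> ?T" for u v w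
    using K_cubic[OF that[THEN ext(1)], of p] ext(2) that unfolding K_at_def by simp
  show "K_at p v (\<phi> p w) = - \<phi> p (K_at p v w)" if "v \<in> ?T" "w \<in> ?T" for v w
  proof -
    let ?X = "extension A p v" and ?Y = "extension A p w"
    note XY = ext(1)[OF that(1)] ext(1)[OF that(2)]
    have "difference_tensor nabla nabla0 ?X (\<lambda>q. \<phi> q (?Y q)) p
        + \<phi> p (difference_tensor nabla nabla0 ?X ?Y p) = 0"
      using manifold_structure XY unfolding almost_contact_statistical_manifold_def by blast
    then have "K ?X (\<lambda>q. \<phi> q (?Y q)) p = - \<phi> p (K ?X ?Y p)"
      unfolding K_def by (rule eq_neg_iff_add_eq_0[THEN iffD2])
    then show ?thesis
      using K_eq_K_at[OF XY(1) phi_field[OF XY(2)], of p] K_eq_K_at[OF XY, of p] ext(2) that by simp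
  qed
qed

lemma K_bracket_eq:
  assumes "X \<in> vector_fields A" "Y \<in> vector_fields A" "Z \<in> vector_fields A"
  shows "K_bracket K X Y Z p =
    K_at p (X p) (K_at p (Y p) (Z p)) - K_at p (Y p) (K_at p (X p) (Z p))"
  using assms by (simp add: K_bracket_def K_eq_K_at K_field)

text \<open>In the sum of the curvatures of \<open>\<nabla>\<^sup>\<circ> + K\<close> and \<open>\<nabla>\<^sup>\<circ> - K\<close> the terms of odd order in \<open>K\<close>
  cancel.\<close>

lemma statistical_curvature_eq:
  assumes X: "X \<in> vector_fields A" and Y: "Y \<in> vector_fields A" and Z: "Z \<in> vector_fields A"
  shows "statistical_curvature A nabla0 nabla X Y Z p = curvature A nabla0 X Y Z p + K_bracket K X Y Z p"
proof -
  let ?bar = "conjugate_connection nabla0 nabla"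
  note fields = K_field connection_field[OF affine(1)]
  have nabla: "nabla U W = (\<lambda>p. nabla0 U W p + K U W p)" for U W
    by (simp add: K_apply)
  have bar: "?bar U W = (\<lambda>p. nabla0 U W p - K U W p)" for U W
    by (simp add: conjugate_connection_def K_def)
  have nabla2: "nabla U (nabla V Z) p
      = nabla0 U (nabla0 V Z) p + nabla0 U (K V Z) p + K U (nabla0 V Z) p + K U (K V Z) p"
    if "U \<in> vector_fields A" "V \<in> vector_fields A" for U V
    unfolding nabla[of V Z]
    using connection_add[OF affine(2), of U "nabla0 V Z" "K V Z"]
      connection_add[OF affine(1), of U "nabla0 V Z" "K V Z"] that Z fields
    by (simp add: K_apply[of U])
  have bar2: "?bar U (?bar V Z) p
      = nabla0 U (nabla0 V Z) p - nabla0 U (K V Z) p - K U (nabla0 V Z) p + K U (K V Z) p"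
    if "U \<in> vector_fields A" "V \<in> vector_fields A" for U V
    unfolding bar[of V Z] bar[of U]
    using connection_diff[OF affine(1), of U "nabla0 V Z" "K V Z"]
      connection_diff[OF affine(2), of U "nabla0 V Z" "K V Z"] that Z fields
    by (simp add: K_apply[of U])
  have "curvature A nabla X Y Z p + curvature A ?bar X Y Z p
      = 2 *\<^sub>R (curvature A nabla0 X Y Z p + K_bracket K X Y Z p)"
    unfolding curvature_def K_bracket_def nabla2[OF X Y] nabla2[OF Y X] bar2[OF X Y] bar2[OF Y X]
      bar[of "lie_bracket A X Y"] nabla[of "lie_bracket A X Y"]
    by (simp add: scaleR_2 algebra_simps)
  then show ?thesis by (simp add: statistical_curvature_def)
qed

lemma spans_phi_section_iff:
  "spans_phi_section A \<phi> \<xi> g p v \<longleftrightarrow> v \<in> tangent_space A p \<and> g p v (\<xi> p) = 0 \<and> v \<noteq> 0"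
  using at.dim_phi_section[of v p] by (auto simp: spans_phi_section_def)

lemma K_bracket_tensor_at:
  assumes "u \<in> tangent_space A p" "v \<in> tangent_space A p" "w \<in> tangent_space A p"
  shows "tensor_at A (K_bracket K) p u v w = K_at p u (K_at p v w) - K_at p v (K_at p u w)"
  using assms by (simp add: tensor_at_def K_bracket_eq extension)

text \<open>The sectional curvature quotient is additive in the tensor, so the splitting
  \<open>S = R\<^sup>\<circ> + [K,K]\<close> passes to it.\<close>

lemma phi_sectional_statistical:
  assumes v: "v \<in> tangent_space A p"
  shows "phi_sectional A \<phi> g (statistical_curvature A nabla0 nabla) p v
    = phi_sectional A \<phi> g (curvature A nabla0) p v + phi_sectional A \<phi> g (K_bracket K) p v"
proof -
  note fv = at.phi_in[OF v]
  let ?X = "extension A p v" and ?Y = "extension A p (\<phi> p v)"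
  note XY = extension(1)[OF v] extension(1)[OF fv]
  note fields = connection_field[OF affine(1)] lie_bracket_field
  have R: "curvature A nabla0 ?X ?Y ?Y p \<in> tangent_space A p"
    unfolding curvature_def
    by (intro subspace_diff[OF subspace_tangent_space] vector_field_tangent fields XY)
  have B: "K_bracket K ?X ?Y ?Y p \<in> tangent_space A p"
    unfolding K_bracket_def
    by (intro subspace_diff[OF subspace_tangent_space] vector_field_tangent K_field XY)
  show ?thesis
    using at.g_add_left[OF R B v] XY
    by (simp add: phi_sectional_def tensor_at_def statistical_curvature_eq add_divide_distrib)
qed

lemma K_horizontal_zero_iff_phi_sectional:
  "(\<forall>p. at.K_horizontal_zero p) \<longleftrightarrow>
    (\<forall>p v. spans_phi_section A \<phi> \<xi> g p v \<longrightarrow> phi_sectional A \<phi> g (K_bracket K) p v = 0)"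
  unfolding at.K_horizontal_zero_iff_phi_sectional spans_phi_section_iff phi_sectional_def
  using K_bracket_tensor_at at.phi_in by auto

lemma K_horizontal_zero_iff_K_eq:
  "(\<forall>p. at.K_horizontal_zero p) \<longleftrightarrow>
    (\<forall>X\<in>vector_fields A. \<forall>Y\<in>vector_fields A. \<forall>p.
       K X Y p = (g p (K \<xi> \<xi> p) (\<xi> p) * \<eta> p (X p) * \<eta> p (Y p)) *\<^sub>R \<xi> p \<and>
       K X Y p = (\<eta> p (X p) * \<eta> p (Y p)) *\<^sub>R K \<xi> \<xi> p)" (is "_ \<longleftrightarrow> ?R")
proof
  assume flat: "\<forall>p. at.K_horizontal_zero p"
  show ?R
  proof (intro ballI allI conjI)
    fix X Y p assume XY: "X \<in> vector_fields A" "Y \<in> vector_fields A"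
    show "K X Y p = (g p (K \<xi> \<xi> p) (\<xi> p) * \<eta> p (X p) * \<eta> p (Y p)) *\<^sub>R \<xi> p"
      unfolding K_eq_K_at[OF XY] K_eq_K_at[OF xi_field xi_field]
      using at.K_horizontal_zero_iff_K_eq[of p] flat vector_field_tangent XY by blast
    show "K X Y p = (\<eta> p (X p) * \<eta> p (Y p)) *\<^sub>R K \<xi> \<xi> p"
      unfolding K_eq_K_at[OF XY] K_eq_K_at[OF xi_field xi_field]
      by (rule at.K_horizontal_zero_imp_K_xi_xi) (use flat vector_field_tangent XY in blast)+
  qed
next
  assume R: ?R
  show "\<forall>p. at.K_horizontal_zero p"
    unfolding at.K_horizontal_zero_iff_K_eq
  proof (intro allI ballI)
    fix p v w assume vw: "v \<in> tangent_space A p" "w \<in> tangent_space A p"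
    note XY = extension(1)[OF vw(1)] extension(1)[OF vw(2)]
    have "K (extension A p v) (extension A p w) p = (g p (K \<xi> \<xi> p) (\<xi> p)
        * \<eta> p (extension A p v p) * \<eta> p (extension A p w p)) *\<^sub>R \<xi> p"
      using R XY by blast
    then show "K_at p v w = (g p (K_at p (\<xi> p) (\<xi> p)) (\<xi> p) * \<eta> p v * \<eta> p w) *\<^sub>R \<xi> p"
      unfolding K_eq_K_at[OF XY] K_eq_K_at[OF xi_field xi_field] extension(2)[OF vw(1)] extension(2)[OF vw(2)] .
  qed
qed

lemma K_horizontal_zero_iff_K_bracket:
  "(\<forall>p. at.K_horizontal_zero p) \<longleftrightarrow> (\<forall>X\<in>vector_fields A. \<forall>Y\<in>vector_fields A. \<forall>Z\<in>vector_fields A. \<forall>p.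
     K_bracket K X Y Z p = 0)" (is "_ \<longleftrightarrow> ?R")
proof
  assume "\<forall>p. at.K_horizontal_zero p"
  then show ?R
    by (simp add: K_bracket_eq at.K_horizontal_zero_imp_bracket vector_field_tangent)
next
  assume R: ?R
  have "phi_sectional A \<phi> g (K_bracket K) p v = 0" if "v \<in> tangent_space A p" for p v
    using that R extension(1)[of _ p] at.phi_in[OF that] at.g_zero_left[OF that]
    by (simp add: phi_sectional_def tensor_at_def)
  then show "\<forall>p. at.K_horizontal_zero p"
    unfolding K_horizontal_zero_iff_phi_sectional spans_phi_section_iff by blast
qed

text \<open>A horizontal vector \<open>v\<close> extends to a field that is horizontal everywhere, up to sign: take
  \<open>\<phi>\<^sup>2\<close> of any extension, which has the value \<open>- v\<close> at \<open>p\<close>.\<close>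

lemma K_horizontal_zero_iff_horizontal_fields:
  "(\<forall>p. at.K_horizontal_zero p) \<longleftrightarrow>
     (\<forall>X\<in>vector_fields A. (\<forall>p. g p (X p) (\<xi> p) = 0) \<longrightarrow> (\<forall>p. K X X p = 0))" (is "_ \<longleftrightarrow> ?R")
proof
  assume "\<forall>p. at.K_horizontal_zero p"
  then show ?R
    by (simp add: K_eq_K_at at.K_horizontal_zero_def vector_field_tangent)
next
  assume R: ?R
  show "\<forall>p. at.K_horizontal_zero p"
    unfolding at.K_horizontal_zero_def
  proof (intro allI ballI impI)
    fix p v assume v: "v \<in> tangent_space A p" "g p v (\<xi> p) = 0"
    define X where "X q = \<phi> q (\<phi> q (extension A p v q))" for q
    have ext: "extension A p v \<in> vector_fields A" by (rule extension(1)[OF v(1)])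
    have X: "X \<in> vector_fields A"
      unfolding X_def by (intro phi_field ext)
    have "g q (X q) (\<xi> q) = 0" for q
      unfolding X_def using vector_field_tangent[OF ext] by (simp add: at.g_xi at.eta_phi at.phi_in)
    then have "K X X p = 0" using R X by blast
    moreover have "X p = - v"
      using v by (simp add: X_def extension(2) at.phi_phi at.g_xi)
    ultimately have "K_at p (- v) (- v) = 0"
      using K_eq_K_at[OF X X, of p] by simp
    then show "K_at p v v = 0"
      using v at.K_scale_right[of "- v" p v "-1"] at.K_scale_right[of v p v "-1"]
        at.K_sym[of "- v" p v] subspace_neg[OF subspace_tangent_space] by simp
  qed
qed

lemma K_horizontal_zero_iff_phi_K:
  "(\<forall>p. at.K_horizontal_zero p) \<longleftrightarrow> (\<forall>X\<in>vector_fields A. \<forall>p. \<phi> p (K X X p) = 0)" (is "_ \<longleftrightarrow> ?R")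
proof
  assume "\<forall>p. at.K_horizontal_zero p"
  then show ?R
    by (simp add: K_eq_K_at at.K_horizontal_zero_iff_phi_K vector_field_tangent)
next
  assume R: ?R
  have "\<phi> p (K_at p v v) = 0" if "v \<in> tangent_space A p" for p v
    using R extension(1)[OF that] unfolding K_at_def by blast
  then show "\<forall>p. at.K_horizontal_zero p"
    unfolding at.K_horizontal_zero_iff_phi_K by blast
qed

lemma K_X_phi_X:
  "X \<in> vector_fields A \<Longrightarrow> K X (\<lambda>q. \<phi> q (X q)) p = - \<phi> p (K X X p)"
  by (simp add: K_eq_K_at phi_field vector_field_tangent at.K_phi)

lemma phi_K_eq_0_iff:
  "X \<in> vector_fields A \<Longrightarrow> \<phi> p (K X X p) = 0 \<longleftrightarrow> (\<exists>c. K X X p = c *\<^sub>R \<xi> p)"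
  by (rule at.phi_eq_0_iff_parallel) (intro vector_field_tangent K_field)

lemma smooth_K_xi_xi_xi: "(\<lambda>p. g p (K \<xi> \<xi> p) (\<xi> p)) \<in> smooth_functions A"
  using metric K_field[OF xi_field xi_field] xi_field unfolding riemannian_metric_def by blast

end


section \<open>The equivalences\<close>

theorem theorem5p8:
  fixes A :: "('m::{t2_space,second_countable_topology}, 'e::euclidean_space) chart set"
    and \<phi> :: "'m \<Rightarrow> ('m, 'e) tvec \<Rightarrow> ('m, 'e) tvec"
    and \<xi> :: "('m, 'e) vfield"
    and \<eta> :: "'m \<Rightarrow> ('m, 'e) tvec \<Rightarrow> real"
    and g :: "('m, 'e) metric"
    and nabla0 nabla :: "('m, 'e) connection"
  assumes "almost_contact_statistical_manifold A \<phi> \<xi> \<eta> g nabla0 nabla"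
  defines "K \<equiv> difference_tensor nabla nabla0"
    and "S \<equiv> statistical_curvature A nabla0 nabla"
    and "R0 \<equiv> curvature A nabla0"
    and "lam \<equiv> (\<lambda>p. g p (difference_tensor nabla nabla0 \<xi> \<xi> p) (\<xi> p))"
  shows "lam \<in> smooth_functions A \<and> all_equivalent
    [\<forall>p v. spans_phi_section A \<phi> \<xi> g p v \<longrightarrow> phi_sectional A \<phi> g (K_bracket K) p v = 0,
     \<forall>p v. spans_phi_section A \<phi> \<xi> g p v \<longrightarrow> phi_sectional A \<phi> g S p v = phi_sectional A \<phi> g R0 p v,
     \<forall>X\<in>vector_fields A. \<forall>Y\<in>vector_fields A. \<forall>p.
       K X Y p = (lam p * \<eta> p (X p) * \<eta> p (Y p)) *\<^sub>R \<xi> p \<and>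
       K X Y p = (\<eta> p (X p) * \<eta> p (Y p)) *\<^sub>R K \<xi> \<xi> p,
     \<forall>X\<in>vector_fields A. \<forall>Y\<in>vector_fields A. \<forall>Z\<in>vector_fields A. \<forall>p. K_bracket K X Y Z p = 0,
     \<forall>X\<in>vector_fields A. \<forall>Y\<in>vector_fields A. \<forall>Z\<in>vector_fields A. \<forall>p. S X Y Z p = R0 X Y Z p,
     \<forall>X\<in>vector_fields A. (\<forall>p. g p (X p) (\<xi> p) = 0) \<longrightarrow> (\<forall>p. K X X p = 0),
     \<forall>X\<in>vector_fields A. \<forall>p. K X (\<lambda>q. \<phi> q (X q)) p = 0,
     \<forall>X\<in>vector_fields A. \<forall>p. \<phi> p (K X X p) = 0,
     \<forall>X\<in>vector_fields A. \<forall>p. \<exists>c. K X X p = c *\<^sub>R \<xi> p]"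
    (is "_ \<and> all_equivalent [?K_phi, ?S_phi, ?K_eq, ?bracket, ?S_eq, ?horizontal, ?K_phi_X, ?phi_K, ?par]")
proof -
  interpret M: almost_contact_statistical A \<phi> \<xi> \<eta> g nabla0 nabla
    by (rule almost_contact_statistical.intro[OF assms(1)])
  have K: "M.K = K" by (simp add: K_def M.K_def)
  have lam: "lam = (\<lambda>p. g p (K \<xi> \<xi> p) (\<xi> p))" by (simp add: lam_def K_def)
  define F where "F \<longleftrightarrow> (\<forall>p. M.at.K_horizontal_zero p)"
  have 1: "?K_phi \<longleftrightarrow> F"
    using M.K_horizontal_zero_iff_phi_sectional unfolding K F_def by (rule sym)
  have "phi_sectional A \<phi> g S p v = phi_sectional A \<phi> g R0 p v \<longleftrightarrow> phi_sectional A \<phi> g (K_bracket K) p v = 0"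
    if "spans_phi_section A \<phi> \<xi> g p v" for p v
    using M.phi_sectional_statistical[of v p] that
    unfolding K S_def R0_def M.spans_phi_section_iff by simp
  with 1 have 2: "?S_phi \<longleftrightarrow> F" by blast
  have 3: "?K_eq \<longleftrightarrow> F"
    using M.K_horizontal_zero_iff_K_eq unfolding K F_def lam by (rule sym)
  have 4: "?bracket \<longleftrightarrow> F"
    using M.K_horizontal_zero_iff_K_bracket unfolding K F_def by (rule sym)
  have "S X Y Z p = R0 X Y Z p \<longleftrightarrow> K_bracket K X Y Z p = 0"
    if "X \<in> vector_fields A" "Y \<in> vector_fields A" "Z \<in> vector_fields A" for X Y Z p
    using M.statistical_curvature_eq[OF that, of p] unfolding K S_def R0_def by simp
  with 4 have 5: "?S_eq \<longleftrightarrow> F" by blast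
  have 6: "?horizontal \<longleftrightarrow> F"
    using M.K_horizontal_zero_iff_horizontal_fields unfolding K F_def by (rule sym)
  have 8: "?phi_K \<longleftrightarrow> F"
    using M.K_horizontal_zero_iff_phi_K unfolding K F_def by (rule sym)
  have 7: "?K_phi_X \<longleftrightarrow> F"
    using 8 M.K_X_phi_X unfolding K by simp
  have 9: "?par \<longleftrightarrow> F"
    using 8 M.phi_K_eq_0_iff unfolding K by simp
  have "lam \<in> smooth_functions A"
    using M.smooth_K_xi_xi_xi unfolding K lam .
  then show ?thesis
    unfolding all_equivalent_def 1 2 3 4 5 6 7 8 9 by simp
qed

end
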